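(* Let $G$ be a divisible totally ordered abelian group, let $n,m$ be positive integers, and let $\phi$ be a combinatorial pivoting strategy with tropicalized strategy $\phi^{\mathrm{trop}}$. Then $$N_{\mathbb{T}}(n,m,\phi^{\mathrm{trop}})\le N_{\mathbb{R}}(n,m,\phi),$$ where $\mathbb{T}=\mathbb{T}[G]$.
   Context: **Classical side.** Given $A\in\mathbb{R}^{m\times n}$, $b\in\mathbb{R}^m$, $c\in\mathbb{R}^n$, consider the linear program: minimize $c^\top x$ subject to $x\in\mathcal{P}(A,b)=\{x\in \mathbb{R}^n: Ax+b\ge0,\ x\ge0\}$. A matrix is *generic* if for each square submatrix $W\in \mathbb{R}^{p\times p}$, either $\det W\neq0$ or every term $\mathrm{sgn}(\sigma)W_{1\sigma(1)}\cdots W_{p\sigma(p)}$ is zero. The program is *non-degenerate* if $\mathcal{P}(A,b)$ is bounded and contained in $\{x>0\}$, and $M=\begin{pmatrix}A&b\\c^\top&0\end{pmatrix}$ is generic. A *basis* is a set $I\subset[m]$, $|I|=n$, with $\det A_I\neq0$ ($A_I$ = rows of $A$ in $I$) such that the point $x$ with $A_Ix+b_I=0$ lies in $\mathcal{P}(A,b)$. The reduced cost of $i\in I$ is $y_i=\det(A_I^{(i\leftarrow c)})/\det A_I$, where $A_I^{(i\leftarrow c)}$ is $A_I$ with row $i$ replaced by $c^\top$ (i.e. $A_I^\top y=c$); $I$ is optimal if no reduced cost is negative. A *run* of the simplex method from an initial basis $I_1$ is a sequence of bases $I_1,\dots,I_N$ with $I_N$ the first optimal one: at a non-optimal $I_k$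 a leaving index $i\in I_k$ with negative reduced cost is chosen, and $I_{k+1}$ is the unique basis different from $I_k$ containing $I_k\setminus\{i\}$; the length of the run is $N$. A *pivoting strategy* is a family $\phi=(\phi_k)_k$ where $\phi_k$ chooses the leaving index at step $k$ from the history $(I_1,\dots,I_k)$ and $A,b,c$. It is *combinatorial* if $\phi_k$ is a function only of the history and of the signs of all minors of $M$ (accessed via an oracle $\Omega$ that, given non-empty $I\subset[m+1]$, $J\subset[n+1]$ with $|I|=|J|$, returns the sign of $\det M_{I,J}$). $N_{\mathbb{R}}(n,m,\phi)$ is the maximal length of a run of the simplex algorithm with strategy $\phi$ over all non-degenerate linear programs over $\mathbb{R}$ with $n$ variables and $m$ constraints (the inequalities $Ax+b\ge 0$), and all initial bases. **Tropical side.** $\mathbb{T}=\mathbb{T}[G]=G\cup\{\mathbf 0_{\mathbb T}\}$, with $\mathbf 0_{\mathbb T}$ smaller than every element of $G$, $a\oplus b=\max(a,b)$, and $a\odot b=a+b$ with $\mathbf 0_{\mathbb T}$ absorbing; matrix operations are extended accordingly. Signed tropical numbers $\mathbb{T}_\pm$: two copies of $\mathbb{T}$, positive elements $a$ and negative elements $\ominus a$, with $\mathbf 0_{\mathbb T}=\ominus\mathbf 0_{\mathbb T}$; signs are $\mathrm{sign}(a)=1$, $\mathrm{sign}(\ominus a)=-1$ for $a\neq\mathbf 0_{\mathbb T}$, and $\mathrm{sign}(\mathbf 0_{\mathbb T})=0$; modulus $|a|=|\ominus a|=a$; $x^+$ is $|x|$ if $x$ is positive and $\mathbf 0_{\mathbb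 T}$ otherwise, $x^-$ is $|x|$ if $x$ is negative and $\mathbf 0_{\mathbb T}$ otherwise (entrywise on matrices). For a square matrix $W\in\mathbb T_\pm^{p\times p}$, $\mathrm{tper}\,W=\max_{\sigma}|W_{1\sigma(1)}|\odot\cdots\odot|W_{p\sigma(p)}|$. $W$ is *tropically non-singular* if $\mathrm{tper}\,W\ne\mathbf 0_{\mathbb T}$ and exactly one permutation $\sigma$ attains the maximum; then the sign of $\mathrm{tper}\,W$ is $\mathrm{sgn}(\sigma)\prod_i\mathrm{sign}(W_{i\sigma(i)})$; the sign is $0$ if $\mathrm{tper}\,W=\mathbf 0_{\mathbb T}$. A matrix is *tropically generic* if each square submatrix $W$ satisfies $\mathrm{tper}\,W=\mathbf 0_{\mathbb T}$ or is tropically non-singular; the signs of its tropical minors are then well defined. A tropical linear program with $n$ variables and $m$ constraints: minimize $c^\top\odot x$ over $\mathcal{P}(A,b)=\{x\in\mathbb{T}^n: A^+\odot x\oplus b^+\ge A^-\odot x\oplus b^-\}$, with $A\in\mathbb{T}_\pm^{m\times n}$, $b\in\mathbb{T}_\pm^m$, $c\in\mathbb{T}^n$. It is *non-degenerate* if $\mathcal{P}(A,b)$ is bounded and contains no point with a $\mathbf 0_{\mathbb T}$ entry, and $\begin{pmatrix}A&b\\c^\top&\mathbf 0_{\mathbb T}\end{pmatrix}$ is tropically generic. For such a program, a *tropical basis* is a set $I\subset[m]$, $|I|=n$, with $\mathrm{tper}\,A_I\neq\mathbf 0_{\mathbb T}$, for which there is a (unique) point $x\in\mathcal{P}(A,b)$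 with $A_i^+\odot x\oplus b_i^+=A_i^-\odot x\oplus b_i^-$ for all $i\in I$. The sign of the tropical reduced cost of $i\in I$ is the product of the signs of $\mathrm{tper}\,A_I^{(i\leftarrow c)}$ and $\mathrm{tper}\,A_I$. The tropical simplex algorithm proceeds from an initial tropical basis exactly like the classical one: it stops at the first tropical basis with no negative reduced cost; otherwise a leaving index $i\in I_k$ with negative tropical reduced cost is chosen and $I_{k+1}$ is the unique tropical basis different from $I_k$ containing $I_k\setminus\{i\}$. The *tropicalized strategy* $\phi^{\mathrm{trop}}$ is the family of functions $\phi_k$ in which the oracle $\Omega$ is replaced by the one returning the signs of the tropical minors of $\begin{pmatrix}A&b\\c^\top&\mathbf 0_{\mathbb T}\end{pmatrix}$. $N_{\mathbb{T}}(n,m,\phi^{\mathrm{trop}})$ is the maximal length of a run of the tropical simplex algorithm with strategy $\phi^{\mathrm{trop}}$ over all non-degenerate tropical linear programs over $\mathbb{T}[G]$ with $n$ variables and $m$ constraints and all initial tropical bases.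
   Formalization: Boundedness of the tropical feasible set means a strict upper bound in G; this is the usual notion for nontrivial G, but excludes feasible programs over the trivial group, where the claim fails (n=m=1, A=(0), b=(⊖0), c=0 gives N_T≥1, N_R=0). *)

theory Defs
  imports
    "Jordan_Normal_Form.Determinant"
    "Jordan_Normal_Form.DL_Submatrix"
    "HOL-Library.Extended_Nat"
begin

text \<open>
  Rows and columns are numbered from 0: the constraints are indexed by \<open>{..<m}\<close>, and in the
  \<open>(m+1) \<times> (n+1)\<close> matrix of a program row \<open>m\<close> is the objective and column \<open>n\<close> is the
  constant term.
\<close>

section \<open>Notions common to both sides\<close>

definition lp_matrix :: "'a::zero mat \<Rightarrow> 'a vec \<Rightarrow> 'a vec \<Rightarrow> 'a mat" where
  "lp_matrix A b c = mat (dim_row A + 1) (dim_col A + 1) (\<lambda>(i, j).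
     if i < dim_row A
     then (if j < dim_col A then A $$ (i, j) else b $ i)
     else (if j < dim_col A then c $ j else 0))"

definition replace_row :: "'a mat \<Rightarrow> nat \<Rightarrow> 'a vec \<Rightarrow> 'a mat" where
  "replace_row A i c =
     mat (dim_row A) (dim_col A) (\<lambda>(k, j). if k = i then c $ j else A $$ (k, j))"

text \<open>
  The classical and the tropical simplex algorithm differ only in the predicates
  \<open>basis I\<close> and \<open>neg I i\<close> (``the reduced cost of \<open>i\<close> at the basis \<open>I\<close> is negative'').
  In a pivot the basis \<open>J\<close> is described by the property that characterises it uniquely
  in a non-degenerate program.
\<close>

definition optimal :: "(nat set \<Rightarrow> nat \<Rightarrow> bool) \<Rightarrow> nat set \<Rightarrow> bool" where
  "optimal neg I \<longleftrightarrow> (\<forall>i\<in>I. \<not> neg I i)"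

definition pivot ::
  "(nat set \<Rightarrow> bool) \<Rightarrow> (nat set \<Rightarrow> nat \<Rightarrow> bool) \<Rightarrow> nat set \<Rightarrow> nat \<Rightarrow> nat set \<Rightarrow> bool" where
  "pivot basis neg I i J \<longleftrightarrow>
     basis I \<and> i \<in> I \<and> neg I i \<and> basis J \<and> J \<noteq> I \<and> I - {i} \<subseteq> J"

definition simplex_path ::
  "(nat set \<Rightarrow> bool) \<Rightarrow> (nat set \<Rightarrow> nat \<Rightarrow> bool) \<Rightarrow> nat set list \<Rightarrow> bool" where
  "simplex_path basis neg Is \<longleftrightarrow>
     Is \<noteq> [] \<and> basis (hd Is) \<and>
     (\<forall>k. Suc k < length Is \<longrightarrow> (\<exists>i. pivot basis neg (Is ! k) i (Is ! Suc k)))"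

text \<open>
  The choice \<open>\<psi>\<close> is applied to the history up to and including the current basis. All bases
  but the last are non-optimal, because a pivot needs an index with negative reduced cost.
\<close>

definition simplex_run ::
  "(nat set \<Rightarrow> bool) \<Rightarrow> (nat set \<Rightarrow> nat \<Rightarrow> bool) \<Rightarrow> (nat set list \<Rightarrow> nat) \<Rightarrow> nat set list \<Rightarrow> bool"
  where
  "simplex_run basis neg \<psi> Is \<longleftrightarrow>
     Is \<noteq> [] \<and> basis (hd Is) \<and> optimal neg (last Is) \<and>
     (\<forall>k. Suc k < length Is \<longrightarrow>
        pivot basis neg (Is ! k) (\<psi> (take (Suc k) Is)) (Is ! Suc k))"

text \<open>
  A \<open>sign_oracle\<close> maps a row and a column index set to the sign of the minor. A family \<open>(\<phi>\<^sub>k)\<^sub>k\<close> of functions of a history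
  of length \<open>k\<close> is one function on lists, \<open>\<phi>\<^sub>k\<close> being its restriction to lists of length \<open>k\<close>.
\<close>

type_synonym sign_oracle = "nat set \<Rightarrow> nat set \<Rightarrow> int"

type_synonym combinatorial_rule = "nat set list \<Rightarrow> sign_oracle \<Rightarrow> nat"

text \<open>
  On index sets that do not describe a non-empty minor the value is the constant 0, which carries
  no information about the program.
\<close>

definition minor_oracle :: "('a mat \<Rightarrow> int) \<Rightarrow> 'a mat \<Rightarrow> sign_oracle" where
  "minor_oracle det_sign M I J =
     (if I \<noteq> {} \<and> J \<noteq> {} \<and> I \<subseteq> {..<dim_row M} \<and> J \<subseteq> {..<dim_col M} \<and> card I = card J
      then det_sign (submatrix M I J) else 0)"


section \<open>Classical linear programs\<close>

definition polyhedron :: "real mat \<Rightarrow> real vec \<Rightarrow> real vec set" where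
  "polyhedron A b = {x \<in> carrier_vec (dim_col A).
     0\<^sub>v (dim_row A) \<le> A *\<^sub>v x + b \<and> 0\<^sub>v (dim_col A) \<le> x}"

definition generic :: "real mat \<Rightarrow> bool" where
  "generic M \<longleftrightarrow> (\<forall>I J. I \<subseteq> {..<dim_row M} \<and> J \<subseteq> {..<dim_col M} \<and> card I = card J \<longrightarrow>
     (let W = submatrix M I J in
        det W \<noteq> 0 \<or>
        (\<forall>p. p permutes {0..<dim_row W} \<longrightarrow>
             of_int (sign p) * (\<Prod>i = 0..<dim_row W. W $$ (i, p i)) = 0)))"

definition nondegenerate_lp :: "nat \<Rightarrow> nat \<Rightarrow> real mat \<Rightarrow> real vec \<Rightarrow> real vec \<Rightarrow> bool" where
  "nondegenerate_lp n m A b c \<longleftrightarrow>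
     A \<in> carrier_mat m n \<and> b \<in> carrier_vec m \<and> c \<in> carrier_vec n \<and>
     (\<exists>B. \<forall>x \<in> polyhedron A b. \<forall>j<n. \<bar>x $ j\<bar> \<le> B) \<and>
     (\<forall>x \<in> polyhedron A b. \<forall>j<n. 0 < x $ j) \<and>
     generic (lp_matrix A b c)"

definition lp_basis :: "real mat \<Rightarrow> real vec \<Rightarrow> nat set \<Rightarrow> bool" where
  "lp_basis A b I \<longleftrightarrow>
     I \<subseteq> {..<dim_row A} \<and> card I = dim_col A \<and> det (submatrix A I UNIV) \<noteq> 0 \<and>
     (\<exists>x \<in> polyhedron A b. \<forall>i\<in>I. row A i \<bullet> x + b $ i = 0)"

definition reduced_cost :: "real mat \<Rightarrow> real vec \<Rightarrow> nat set \<Rightarrow> nat \<Rightarrow> real" where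
  "reduced_cost A c I i = det (submatrix (replace_row A i c) I UNIV) / det (submatrix A I UNIV)"

definition neg_reduced_cost :: "real mat \<Rightarrow> real vec \<Rightarrow> nat set \<Rightarrow> nat \<Rightarrow> bool" where
  "neg_reduced_cost A c I i \<longleftrightarrow> reduced_cost A c I i < 0"

type_synonym strategy = "nat set list \<Rightarrow> real mat \<Rightarrow> real vec \<Rightarrow> real vec \<Rightarrow> nat"

definition pivoting_strategy :: "nat \<Rightarrow> nat \<Rightarrow> strategy \<Rightarrow> bool" where
  "pivoting_strategy n m \<psi> \<longleftrightarrow> (\<forall>A b c Is.
     nondegenerate_lp n m A b c \<and> simplex_path (lp_basis A b) (neg_reduced_cost A c) Is \<and>
     \<not> optimal (neg_reduced_cost A c) (last Is) \<longrightarrow>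
     \<psi> Is A b c \<in> last Is \<and> neg_reduced_cost A c (last Is) (\<psi> Is A b c))"

definition det_sign :: "real mat \<Rightarrow> int" where
  "det_sign W = (if det W > 0 then 1 else if det W < 0 then -1 else 0)"

definition classical_strategy :: "combinatorial_rule \<Rightarrow> strategy" where
  "classical_strategy \<phi> = (\<lambda>Is A b c. \<phi> Is (minor_oracle det_sign (lp_matrix A b c)))"

text \<open>
  The maximal length is a supremum in \<^typ>\<open>enat\<close>, so that no boundedness has to be presupposed.
  It is 0 if there are no runs at all (for instance if \<open>m < n\<close>).
\<close>

definition N_real :: "nat \<Rightarrow> nat \<Rightarrow> strategy \<Rightarrow> enat" where
  "N_real n m \<psi> = Sup {enat (length Is) | Is A b c.
     nondegenerate_lp n m A b c \<and>
     simplex_run (lp_basis A b) (neg_reduced_cost A c) (\<lambda>h. \<psi> h A b c) Is}"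


section \<open>Tropical numbers\<close>

text \<open>
  The tropical operations are the semiring operations of the type \<open>'g trop\<close>: \<open>a + b\<close> is
  \<open>max a b\<close>, \<open>a * b\<close> is the sum in the group, \<open>0\<close> is \<open>TZero\<close> and \<open>1\<close> is the neutral element
  of the group. The generic \<open>\<Sum>\<close>, \<open>\<Prod>\<close>, \<open>\<bullet>\<close> and \<open>*\<^sub>v\<close> are then the tropical ones.
\<close>

datatype 'g trop = TZero | TVal 'g

instantiation trop :: (linorder) linorder
begin

fun less_eq_trop :: "'a trop \<Rightarrow> 'a trop \<Rightarrow> bool" where
  "TZero \<le> y \<longleftrightarrow> True"
| "TVal a \<le> TZero \<longleftrightarrow> False"
| "TVal a \<le> TVal b \<longleftrightarrow> a \<le> b"

definition less_trop :: "'a trop \<Rightarrow> 'a trop \<Rightarrow> bool" where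
  "x < y \<longleftrightarrow> x \<le> y \<and> \<not> y \<le> (x :: 'a trop)"

instance
proof
  fix x y z :: "'a trop"
  show "x < y \<longleftrightarrow> x \<le> y \<and> \<not> y \<le> x" by (rule less_trop_def)
  show "x \<le> x" by (cases x) auto
  show "x \<le> y \<Longrightarrow> y \<le> z \<Longrightarrow> x \<le> z" by (cases x; cases y; cases z) auto
  show "x \<le> y \<Longrightarrow> y \<le> x \<Longrightarrow> x = y" by (cases x; cases y) auto
  show "x \<le> y \<or> y \<le> x" by (cases x; cases y) auto
qed

end

instantiation trop :: (linordered_ab_group_add) comm_semiring_1
begin

definition zero_trop :: "'a trop" where "0 = TZero"

definition one_trop :: "'a trop" where "1 = TVal 0"

definition plus_trop :: "'a trop \<Rightarrow> 'a trop \<Rightarrow> 'a trop" where "plus_trop x y = max x y"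

fun times_trop :: "'a trop \<Rightarrow> 'a trop \<Rightarrow> 'a trop" where
  "TZero * y = TZero"
| "TVal a * TZero = TZero"
| "TVal a * TVal b = TVal (a + b)"

instance
proof
  fix x y z :: "'a trop"
  show "x + y + z = x + (y + z)" by (simp add: plus_trop_def max.assoc)
  show "x + y = y + x" by (simp add: plus_trop_def max.commute)
  show "0 + x = x" by (cases x) (auto simp: plus_trop_def zero_trop_def max_def)
  show "x * y * z = x * (y * z)" by (cases x; cases y; cases z) (auto simp: add.assoc)
  show "x * y = y * x" by (cases x; cases y) (auto simp: add.commute)
  show "1 * x = x" by (cases x) (auto simp: one_trop_def)
  show "(x + y) * z = x * z + y * z"
    by (cases x; cases y; cases z) (auto simp: plus_trop_def max_def)
  show "0 * x = 0" by (simp add: zero_trop_def)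
  show "x * 0 = 0" by (cases x) (auto simp: zero_trop_def)
  show "(0 :: 'a trop) \<noteq> 1" by (simp add: zero_trop_def one_trop_def)
qed

end

datatype 'g signed_trop = SZero | SPos 'g | SNeg 'g

instantiation signed_trop :: (type) zero
begin

definition zero_signed_trop :: "'a signed_trop" where "0 = SZero"

instance ..

end

fun modulus :: "'g signed_trop \<Rightarrow> 'g trop" where
  "modulus SZero = TZero"
| "modulus (SPos a) = TVal a"
| "modulus (SNeg a) = TVal a"

fun trop_sign :: "'g signed_trop \<Rightarrow> int" where
  "trop_sign SZero = 0"
| "trop_sign (SPos a) = 1"
| "trop_sign (SNeg a) = -1"

fun pos_part :: "'g signed_trop \<Rightarrow> 'g trop" where
  "pos_part SZero = TZero"
| "pos_part (SPos a) = TVal a"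
| "pos_part (SNeg a) = TZero"

fun neg_part :: "'g signed_trop \<Rightarrow> 'g trop" where
  "neg_part SZero = TZero"
| "neg_part (SPos a) = TZero"
| "neg_part (SNeg a) = TVal a"

fun to_signed :: "'g trop \<Rightarrow> 'g signed_trop" where
  "to_signed TZero = SZero"
| "to_signed (TVal a) = SPos a"


section \<open>Tropical linear programs\<close>

definition tper_term ::
  "'g::linordered_ab_group_add signed_trop mat \<Rightarrow> (nat \<Rightarrow> nat) \<Rightarrow> 'g trop" where
  "tper_term W p = (\<Prod>i = 0..<dim_row W. modulus (W $$ (i, p i)))"

definition tper :: "'g::linordered_ab_group_add signed_trop mat \<Rightarrow> 'g trop" where
  "tper W = (\<Sum>p | p permutes {0..<dim_row W}. tper_term W p)"

definition trop_nonsingular :: "'g::linordered_ab_group_add signed_trop mat \<Rightarrow> bool" where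
  "trop_nonsingular W \<longleftrightarrow>
     tper W \<noteq> 0 \<and> (\<exists>!p. p permutes {0..<dim_row W} \<and> tper_term W p = tper W)"

text \<open>The sign is meaningful only if \<open>W\<close> is tropically non-singular or \<open>tper W = 0\<close>.\<close>

definition tper_sign :: "'g::linordered_ab_group_add signed_trop mat \<Rightarrow> int" where
  "tper_sign W =
     (if tper W = 0 then 0
      else let p = (THE p. p permutes {0..<dim_row W} \<and> tper_term W p = tper W)
           in sign p * (\<Prod>i = 0..<dim_row W. trop_sign (W $$ (i, p i))))"

definition trop_generic :: "'g::linordered_ab_group_add signed_trop mat \<Rightarrow> bool" where
  "trop_generic M \<longleftrightarrow> (\<forall>I J. I \<subseteq> {..<dim_row M} \<and> J \<subseteq> {..<dim_col M} \<and> card I = card J \<longrightarrow>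
     (let W = submatrix M I J in tper W = 0 \<or> trop_nonsingular W))"

abbreviation trop_lhs ::
  "'g::linordered_ab_group_add signed_trop mat \<Rightarrow> 'g signed_trop vec \<Rightarrow> 'g trop vec \<Rightarrow> 'g trop vec"
  where
  "trop_lhs A b x \<equiv> map_mat pos_part A *\<^sub>v x + map_vec pos_part b"

abbreviation trop_rhs ::
  "'g::linordered_ab_group_add signed_trop mat \<Rightarrow> 'g signed_trop vec \<Rightarrow> 'g trop vec \<Rightarrow> 'g trop vec"
  where
  "trop_rhs A b x \<equiv> map_mat neg_part A *\<^sub>v x + map_vec neg_part b"

definition trop_polyhedron ::
  "'g::linordered_ab_group_add signed_trop mat \<Rightarrow> 'g signed_trop vec \<Rightarrow> 'g trop vec set" where
  "trop_polyhedron A b = {x \<in> carrier_vec (dim_col A). trop_rhs A b x \<le> trop_lhs A b x}"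

abbreviation trop_lp_matrix ::
  "'g signed_trop mat \<Rightarrow> 'g signed_trop vec \<Rightarrow> 'g trop vec \<Rightarrow> 'g signed_trop mat" where
  "trop_lp_matrix A b c \<equiv> lp_matrix A b (map_vec to_signed c)"

text \<open>
  Boundedness asks for a strict upper bound in the group. If the group is non-trivial, this is the
  same as asking for an upper bound. Over the trivial group every set has an upper bound, which
  would make the condition void.
\<close>

definition nondegenerate_trop_lp ::
  "nat \<Rightarrow> nat \<Rightarrow> 'g::linordered_ab_group_add signed_trop mat \<Rightarrow> 'g signed_trop vec \<Rightarrow>
   'g trop vec \<Rightarrow> bool" where
  "nondegenerate_trop_lp n m A b c \<longleftrightarrow>
     A \<in> carrier_mat m n \<and> b \<in> carrier_vec m \<and> c \<in> carrier_vec n \<and>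
     (\<exists>g. \<forall>x \<in> trop_polyhedron A b. \<forall>j<n. x $ j < TVal g) \<and>
     (\<forall>x \<in> trop_polyhedron A b. \<forall>j<n. x $ j \<noteq> 0) \<and>
     trop_generic (trop_lp_matrix A b c)"

definition trop_basis ::
  "'g::linordered_ab_group_add signed_trop mat \<Rightarrow> 'g signed_trop vec \<Rightarrow> nat set \<Rightarrow> bool" where
  "trop_basis A b I \<longleftrightarrow>
     I \<subseteq> {..<dim_row A} \<and> card I = dim_col A \<and> tper (submatrix A I UNIV) \<noteq> 0 \<and>
     (\<exists>x \<in> trop_polyhedron A b. \<forall>i\<in>I. trop_lhs A b x $ i = trop_rhs A b x $ i)"

definition trop_reduced_cost_sign ::
  "'g::linordered_ab_group_add signed_trop mat \<Rightarrow> 'g trop vec \<Rightarrow> nat set \<Rightarrow> nat \<Rightarrow> int" where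
  "trop_reduced_cost_sign A c I i =
     tper_sign (submatrix (replace_row A i (map_vec to_signed c)) I UNIV) *
     tper_sign (submatrix A I UNIV)"

definition neg_trop_reduced_cost ::
  "'g::linordered_ab_group_add signed_trop mat \<Rightarrow> 'g trop vec \<Rightarrow> nat set \<Rightarrow> nat \<Rightarrow> bool" where
  "neg_trop_reduced_cost A c I i \<longleftrightarrow> trop_reduced_cost_sign A c I i < 0"

type_synonym 'g trop_strategy =
  "nat set list \<Rightarrow> 'g signed_trop mat \<Rightarrow> 'g signed_trop vec \<Rightarrow> 'g trop vec \<Rightarrow> nat"

definition tropicalized_strategy ::
  "combinatorial_rule \<Rightarrow> 'g::linordered_ab_group_add trop_strategy" where
  "tropicalized_strategy \<phi> =
     (\<lambda>Is A b c. \<phi> Is (minor_oracle tper_sign (trop_lp_matrix A b c)))"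

definition N_trop :: "nat \<Rightarrow> nat \<Rightarrow> 'g::linordered_ab_group_add trop_strategy \<Rightarrow> enat" where
  "N_trop n m \<psi> = Sup {enat (length Is) | Is A b c.
     nondegenerate_trop_lp n m A b c \<and>
     simplex_run (trop_basis A b) (neg_trop_reduced_cost A c) (\<lambda>h. \<psi> h A b c) Is}"

end

theory Submission
  imports Defs
begin

text \<open>
  A non-degenerate tropical program is replaced by a real one with the same signs of minors: an
  additive map \<open>h : G \<rightarrow> \<real>\<close> that is large on finitely many prescribed positive elements of \<open>G\<close>
  turns an entry of modulus \<open>g\<close> into \<open>\<plusminus>exp (h g)\<close>, and in every minor the unique maximal term
  dominates the sum of the others, even if the entries are changed by bounded positive factors.

  A tropical basis with its tropical point becomes a basis of a real program whose entries are
  changed by such factors; since by Cramer's rule being a basis depends only on the signs of the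
  minors, it is a basis of the lifted program too. Conversely, the logarithms of a feasible real
  point solve the tropical inequalities up to a bounded error. The latter are difference
  constraints, so an exact solution over \<open>G\<close> exists; hence the lifted program inherits
  boundedness and positivity. A tropical run is then literally a run of the lifted program.
\<close>

text \<open>\<open>G\<close> need not be Archimedean, so it may have no order embedding into the
  reals: \<open>h\<close> can only respect the order on a finite set fixed in advance. Hence
  everything to be compared later is collected first: the entries of the program, a strict bound
  \<open>g\<close> for its polyhedron and the coordinates of one point per tropical basis, together
  with sums of boundedly many differences of these. The bound \<open>2 ^ Suc n\<close> on their
  number arises because the difference constraints live on at most n + 1 vertices, the variables and
  a homogenizing coordinate, and each elimination doubles the length of the sums.

  The second obstacle is that the exponential of a tropical basic point need not lie on the
  hyperplanes of the lifted program: a tie between the two sides of a tropical equation does not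
  make the real sum zero. Entries can be corrected by bounded factors, but differently for each
  basis, whereas a run needs one program for all its bases. The signs of minors are what all
  corrected programs share.\<close>

section \<open>Order-preserving homomorphisms into the reals\<close>

lemma between_finite_sets:
  fixes A B :: "'a::{dense_linorder, no_top, no_bot} set"
  assumes "finite A" "finite B" and "\<And>a b. a \<in> A \<Longrightarrow> b \<in> B \<Longrightarrow> a < b"
  obtains x where "\<And>a. a \<in> A \<Longrightarrow> a < x" "\<And>b. b \<in> B \<Longrightarrow> x < b"
proof (cases "A = {}")
  case True
  show ?thesis
  proof (cases "B = {}")
    case False
    obtain x where "x < Min B"
      using lt_ex by blast
    with that True False \<open>finite B\<close> show ?thesis
      by auto
  qed (use True that in auto)
next
  case nonempty: False
  show ?thesis
  proof (cases "B = {}")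
    case True
    obtain x where "Max A < x"
      using gt_ex by blast
    with that True nonempty \<open>finite A\<close> show ?thesis
      by auto
  next
    case False
    have "Max A < Min B"
      using assms nonempty False by auto
    then obtain x where "Max A < x" "x < Min B"
      using dense by blast
    with that nonempty False assms(1,2) show ?thesis
      by auto
  qed
qed

locale ordered_rat_vector_space = vector_space scale
  for scale :: "rat \<Rightarrow> 'g::linordered_ab_group_add \<Rightarrow> 'g" (infixr \<open>*s\<close> 75) +
  assumes scale_pos: "0 < r \<Longrightarrow> 0 < x \<Longrightarrow> 0 < r *s x"
begin

text \<open>
  Fourier--Motzkin elimination: the combinations \<open>l / l v - k / k v\<close> with \<open>l v > 0 > k v\<close>
  do not involve the variable \<open>v\<close>, and they are positive over the group.
\<close>

lemma strict_system_solvable: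
  fixes g :: "'i \<Rightarrow> 'g" and L :: "('i \<Rightarrow> rat) set"
  assumes "finite B" "finite L" "\<And>l. l \<in> L \<Longrightarrow> 0 < (\<Sum>b\<in>B. l b *s g b)"
  shows "\<exists>w :: 'i \<Rightarrow> rat. \<forall>l\<in>L. 0 < (\<Sum>b\<in>B. l b * w b)"
  using assms
proof (induction B arbitrary: L rule: finite_induct)
  case empty
  then show ?case by fastforce
next
  case (insert v B)
  define P where "P = {l \<in> L. 0 < l v}"
  define N where "N = {l \<in> L. l v < 0}"
  define Z where "Z = {l \<in> L. l v = 0}"
  define comb where "comb = (\<lambda>(l, k) b. l b / l v - k b / (k v :: rat) :: rat)"
  define L' where "L' = Z \<union> comb ` (P \<times> N)"
  have pos: "0 < l v *s g v + (\<Sum>b\<in>B. l b *s g b)" if "l \<in> L" for l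
    using insert.prems(2)[OF that] insert.hyps by simp
  have "\<exists>w :: 'i \<Rightarrow> rat. \<forall>l\<in>L'. 0 < (\<Sum>b\<in>B. l b * w b)"
  proof (rule insert.IH)
    show "finite L'"
      using insert.prems(1) by (auto simp: L'_def P_def N_def Z_def)
    fix l' assume "l' \<in> L'"
    then consider "l' \<in> Z" | l k where "l \<in> P" "k \<in> N" "l' = comb (l, k)"
      by (auto simp: L'_def)
    then show "0 < (\<Sum>b\<in>B. l' b *s g b)"
    proof cases
      case 1
      then show ?thesis
        using pos[of l'] by (auto simp: Z_def)
    next
      case 2
      have "0 < inverse (l v) *s (l v *s g v + (\<Sum>b\<in>B. l b *s g b))"
        using 2 pos[of l] by (intro scale_pos) (auto simp: P_def)
      moreover have "0 < inverse (- k v) *s (k v *s g v + (\<Sum>b\<in>B. k b *s g b))"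
        using 2 pos[of k] by (intro scale_pos) (auto simp: N_def)
      ultimately have "0 < inverse (l v) *s (l v *s g v + (\<Sum>b\<in>B. l b *s g b))
          + inverse (- k v) *s (k v *s g v + (\<Sum>b\<in>B. k b *s g b))"
        by (rule add_pos_pos)
      also have "\<dots> = (\<Sum>b\<in>B. l' b *s g b)"
        using 2
        by (simp add: P_def N_def comb_def scale_right_distrib scale_sum_right
            scale_left_diff_distrib sum_subtractf divide_inverse mult.commute sum_negf)
      finally show ?thesis .
    qed
  qed
  then obtain w :: "'i \<Rightarrow> rat" where w: "\<And>l. l \<in> L' \<Longrightarrow> 0 < (\<Sum>b\<in>B. l b * w b)"
    by blast
  \<comment> \<open>Divided by \<open>l v\<close>, the constraint \<open>l\<close> becomes the lower
    bound \<open>- S l\<close> for the value of \<open>v\<close> if \<open>l v\<close> is positive,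
    and an upper bound if it is negative. Positivity of \<open>comb (l, k)\<close> says that these
    bounds are compatible.\<close>
  define S where "S l = (\<Sum>b\<in>B. l b * w b) / l v" for l
  have "- S l < - S k" if "l \<in> P" "k \<in> N" for l k
  proof -
    have "0 < (\<Sum>b\<in>B. comb (l, k) b * w b)"
      using that by (intro w) (auto simp: L'_def)
    also have "\<dots> = S l - S k"
      by (simp add: comb_def S_def sum_divide_distrib left_diff_distrib sum_subtractf)
    finally show ?thesis by simp
  qed
  then have "\<And>a b. a \<in> (\<lambda>l. - S l) ` P \<Longrightarrow> b \<in> (\<lambda>k. - S k) ` N \<Longrightarrow> a < b"
    by blast
  moreover have "finite ((\<lambda>l. - S l) ` P)" "finite ((\<lambda>k. - S k) ` N)"
    using insert.prems(1) by (auto simp: P_def N_def)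
  ultimately obtain x where "\<And>a. a \<in> (\<lambda>l. - S l) ` P \<Longrightarrow> a < x"
      "\<And>b. b \<in> (\<lambda>k. - S k) ` N \<Longrightarrow> x < b"
    using between_finite_sets by metis
  then have x: "\<And>l. l \<in> P \<Longrightarrow> - S l < x" "\<And>k. k \<in> N \<Longrightarrow> x < - S k"
    by blast+
  have "0 < (\<Sum>b\<in>insert v B. l b * (w(v := x)) b)" if "l \<in> L" for l
  proof -
    have eq: "(\<Sum>b\<in>insert v B. l b * (w(v := x)) b) = l v * x + (\<Sum>b\<in>B. l b * w b)"
      using insert.hyps by (auto intro!: sum.cong)
    show ?thesis
    proof (cases "l v" "0 :: rat" rule: linorder_cases)
      case less
      then have "x < - S l"
        using that by (intro x) (auto simp: N_def)
      then show ?thesis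
        using less unfolding eq by (simp add: S_def field_simps)
    next
      case equal
      then show ?thesis
        using w[of l] that unfolding eq by (auto simp: L'_def Z_def)
    next
      case greater
      then have "- S l < x"
        using that by (intro x) (auto simp: P_def)
      then show ?thesis
        using greater unfolding eq by (simp add: S_def field_simps)
    qed
  qed
  then show ?case by blast
qed

text \<open>In coordinates with respect to a rational basis, positivity on \<open>F\<close> is a
  finite strict system in the values of the map on finitely many basis vectors. These vectors
  themselves solve it over \<open>'g\<close>, so it has a rational solution; the other basis vectors
  are sent to zero.\<close>

lemma additive_positive:
  assumes "finite F" "\<And>x. x \<in> F \<Longrightarrow> 0 < x"
  shows "\<exists>h :: 'g \<Rightarrow> real. (\<forall>x y. h (x + y) = h x + h y) \<and> (\<forall>x\<in>F. 0 < h x)"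
proof -
  define C where "C = extend_basis {}"
  have C: "independent C" "span C = UNIV"
    using independent_empty by (simp_all add: C_def independent_extend_basis)
  define B where "B = (\<Union>x\<in>F. {b. representation C x b \<noteq> 0})"
  have "finite B"
    using assms(1) by (auto simp: B_def finite_representation)
  have "(\<Sum>b\<in>B. representation C x b *s b) = x" if "x \<in> F" for x
  proof -
    have "(\<Sum>b\<in>B. representation C x b *s b)
        = (\<Sum>b | representation C x b \<noteq> 0. representation C x b *s b)"
      using that \<open>finite B\<close> by (intro sum.mono_neutral_right) (auto simp: B_def)
    then show ?thesis
      using C by (simp add: sum_nonzero_representation_eq)
  qed
  then have "\<exists>w :: 'g \<Rightarrow> rat. \<forall>l\<in>representation C ` F. 0 < (\<Sum>b\<in>B. l b * w b)"
    using assms \<open>finite B\<close> by (intro strict_system_solvable[where g = "\<lambda>b. b"]) auto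
  then obtain w where w: "\<And>x. x \<in> F \<Longrightarrow> 0 < (\<Sum>b\<in>B. representation C x b * w b)"
    by blast
  define h where "h x = (of_rat (\<Sum>b\<in>B. representation C x b * w b) :: real)" for x
  have "h (x + y) = h x + h y" for x y
    using C by (simp add: h_def representation_add distrib_right sum.distrib of_rat_add)
  moreover have "\<forall>x\<in>F. 0 < h x"
    using w by (simp add: h_def)
  ultimately show ?thesis by blast
qed

end


section \<open>Integer and rational multiples in a divisible ordered abelian group\<close>

definition zmult :: "int \<Rightarrow> 'g::ab_group_add \<Rightarrow> 'g" where
  "zmult z x = (\<Sum>i<nat z. x) - (\<Sum>i<nat (- z). x)"

lemma sum_lessThan_add_const: "(\<Sum>i<m + n. x) = (\<Sum>i<m. x) + (\<Sum>i<(n::nat). x)"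
  for x :: "'g::ab_group_add"
  by (induction m) (simp_all add: add_ac)

text \<open>Any difference of naturals may represent the integer, so additivity in the integer needs
  no cases on signs.\<close>

lemma zmult_diff: "zmult (int m - int n) x = (\<Sum>i<m. x) - (\<Sum>i<n. x)"
proof (cases "n \<le> m")
  case True
  then obtain k where "m = k + n" using le_Suc_ex by (metis add.commute)
  then show ?thesis by (simp add: zmult_def sum_lessThan_add_const)
next
  case False
  then obtain k where "n = k + m" using le_Suc_ex by (metis add.commute nat_le_linear)
  then show ?thesis by (simp add: zmult_def sum_lessThan_add_const)
qed

lemma zmult_nonneg: "0 \<le> z \<Longrightarrow> zmult z x = (\<Sum>i<nat z. x)"
  by (simp add: zmult_def)

lemma zmult_0_right [simp]: "zmult z 0 = 0"
  and zmult_0_left [simp]: "zmult 0 x = 0"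
  and zmult_1 [simp]: "zmult 1 x = x"
  by (simp_all add: zmult_def)

lemma zmult_add_right: "zmult z (x + y) = zmult z x + zmult z y"
  by (simp add: zmult_def sum.distrib)

lemma zmult_minus_right: "zmult z (- x) = - zmult z x"
  by (simp add: zmult_def sum_negf)

lemma zmult_add_left: "zmult (y + z) x = zmult y x + zmult z x"
proof -
  obtain a b where y: "y = int a - int b" by (rule int_diff_cases)
  obtain c d where z: "z = int c - int d" by (rule int_diff_cases)
  have "y + z = int (a + c) - int (b + d)"
    using y z by simp
  then have "zmult (y + z) x = (\<Sum>i<a + c. x) - (\<Sum>i<b + d. x)"
    using zmult_diff by metis
  then show ?thesis
    unfolding y z zmult_diff by (simp add: sum_lessThan_add_const)
qed

lemma zmult_minus_left: "zmult (- z) x = - zmult z x"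
  using zmult_add_left[of "- z" z x] by (simp add: eq_neg_iff_add_eq_0)

lemma zmult_mult: "zmult (y * z) x = zmult y (zmult z x)"
proof (induction y rule: int_induct[where k = 0])
  case (step1 i)
  then show ?case by (simp add: distrib_right zmult_add_left)
next
  case (step2 i)
  then show ?case
    using zmult_add_left[of "i * z" "- z" x] zmult_add_left[of i "- 1" "zmult z x"]
    by (simp add: left_diff_distrib zmult_minus_left)
qed simp

lemma zmult_pos: "0 < z \<Longrightarrow> 0 < x \<Longrightarrow> 0 < zmult z x"
  for x :: "'g::linordered_ab_group_add"
  by (auto simp: zmult_nonneg lessThan_empty_iff intro!: sum_pos)

text \<open>Torsion-freeness is due to the total order: if \<open>x\<close> is non-zero,
  \<open>x\<close> or \<open>- x\<close> is positive, and so are its positive multiples.\<close>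

lemma zmult_eq_0: "z \<noteq> 0 \<Longrightarrow> zmult z x = 0 \<Longrightarrow> x = 0"
  for x :: "'g::linordered_ab_group_add"
  using zmult_pos[of z x] zmult_pos[of z "- x"] zmult_pos[of "- z" x] zmult_pos[of "- z" "- x"]
  by (cases z "0 :: int" rule: linorder_cases; cases x "0 :: 'g" rule: linorder_cases)
     (auto simp: zmult_minus_left zmult_minus_right)

lemma zmult_inj: "z \<noteq> 0 \<Longrightarrow> zmult z x = zmult z y \<Longrightarrow> x = y"
  for x :: "'g::linordered_ab_group_add"
  using zmult_eq_0[of z "x - y"] zmult_add_right[of z x "- y"] by (simp add: zmult_minus_right)

text \<open>The quotient exists by divisibility and is unique by torsion-freeness;
  \<open>quotient_of\<close> gives a reduced fraction with positive denominator.\<close>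

definition qmult :: "rat \<Rightarrow> 'g::ab_group_add \<Rightarrow> 'g" where
  "qmult r x = (THE y. zmult (snd (quotient_of r)) y = zmult (fst (quotient_of r)) x)"

locale divisible_group =
  fixes dummy :: "'g::linordered_ab_group_add itself"
  assumes divisible: "\<And>(x :: 'g) k :: nat. 0 < k \<Longrightarrow> \<exists>y. (\<Sum>i<k. y) = x"
begin

text \<open>Cancellation frees \<open>qmult\<close> from the reduced fraction of its definition, so
  that the vector space laws can be checked over a common denominator.\<close>

lemma qmult_eq_iff:
  fixes x y :: 'g
  assumes "b \<noteq> 0" "r = of_int a / of_int b"
  shows "qmult r x = y \<longleftrightarrow> zmult b y = zmult a x"
proof -
  obtain c d where cd: "quotient_of r = (c, d)" by fastforce
  then have "0 < d" "r = of_int c / of_int d"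
    by (simp_all add: quotient_of_denom_pos quotient_of_div)
  then have "(of_int (a * d) :: rat) = of_int (c * b)"
    using assms by (simp add: field_simps)
  then have ad: "a * d = c * b"
    by (simp only: of_int_eq_iff)
  obtain y0 where y0: "zmult d y0 = zmult c x"
    using divisible[of "nat d" "zmult c x"] \<open>0 < d\<close> by (auto simp: zmult_nonneg)
  then have "qmult r x = y0"
    unfolding qmult_def cd using \<open>0 < d\<close> 
    by (intro the_equality) (auto intro: zmult_inj[of d])
  moreover have "zmult b y0 = zmult a x"
  proof (rule zmult_inj)
    show "d \<noteq> 0" using \<open>0 < d\<close> by simp
    have "zmult d (zmult b y0) = zmult b (zmult d y0)"
      by (simp add: zmult_mult[symmetric] mult.commute)
    also have "\<dots> = zmult d (zmult a x)"
      using ad by (simp add: y0 zmult_mult[symmetric] mult.commute)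
    finally show "zmult d (zmult b y0) = zmult d (zmult a x)" .
  qed
  ultimately show ?thesis
    using assms(1) zmult_inj by metis
qed

lemma rat_vector_space: "ordered_rat_vector_space (qmult :: rat \<Rightarrow> 'g \<Rightarrow> 'g)"
proof
  fix r s :: rat and x y :: 'g
  obtain a b where r: "r = of_int a / of_int b" "0 < b"
    by (metis quotient_of_denom_pos quotient_of_div surj_pair)
  obtain c d where s: "s = of_int c / of_int d" "0 < d"
    by (metis quotient_of_denom_pos quotient_of_div surj_pair)
  have r_eq: "zmult b (qmult r z) = zmult a z" for z :: 'g
    using qmult_eq_iff[OF _ r(1), of z "qmult r z"] r(2) by simp
  have s_eq: "zmult d (qmult s z) = zmult c z" for z :: 'g
    using qmult_eq_iff[OF _ s(1), of z "qmult s z"] s(2) by simp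
  have bd: "b * d \<noteq> 0" using r s by simp
  show "qmult r (x + y) = qmult r x + qmult r y"
    using r(2) by (subst qmult_eq_iff[OF _ r(1)]) (simp_all add: zmult_add_right r_eq)
  have "r + s = of_int (a * d + b * c) / of_int (b * d)"
    using r s by (simp add: field_simps)
  moreover have "zmult (b * d) (qmult r x + qmult s x) = zmult (a * d + b * c) x"
  proof -
    have "zmult (b * d) (qmult r x) = zmult (a * d) x"
      using r_eq[of x] by (metis mult.commute zmult_mult)
    moreover have "zmult (b * d) (qmult s x) = zmult (b * c) x"
      using s_eq[of x] by (simp add: zmult_mult)
    ultimately show ?thesis
      by (simp add: zmult_add_right zmult_add_left)
  qed
  ultimately show "qmult (r + s) x = qmult r x + qmult s x"
    using qmult_eq_iff[OF bd] by blast
  have "r * s = of_int (a * c) / of_int (b * d)"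
    using r s by simp
  moreover have "zmult (b * d) (qmult r (qmult s x)) = zmult (a * c) x"
  proof -
    have "zmult (b * d) (qmult r (qmult s x)) = zmult d (zmult a (qmult s x))"
      by (metis mult.commute r_eq zmult_mult)
    also have "\<dots> = zmult a (zmult c x)"
      by (metis mult.commute s_eq zmult_mult)
    finally show ?thesis by (simp add: zmult_mult)
  qed
  ultimately show "qmult r (qmult s x) = qmult (r * s) x"
    using qmult_eq_iff[OF bd] by metis
  show "qmult 1 x = x"
    using qmult_eq_iff[of 1 1 1 x x] by simp
  show "0 < qmult r x" if "0 < r" "0 < x"
  proof (rule ccontr)
    assume "\<not> 0 < qmult r x"
    then have "qmult r x = 0 \<or> 0 < - qmult r x" by auto
    then have "\<not> 0 < zmult b (qmult r x)"
      using zmult_pos[of b "- qmult r x"] r(2) by (auto simp: zmult_minus_right)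
    moreover have "0 < a"
      using that(1) r by (simp add: zero_less_divide_iff)
    ultimately show False
      using zmult_pos[of a x] that(2) by (simp add: r_eq)
  qed
qed

text \<open>Positivity on finitely many elements leaves a positive lower bound \<open>e\<close>, and
  a large positive real multiple of \<open>h\<close> is still additive.\<close>

lemma additive_large:
  fixes F :: "'g set"
  assumes "finite F"
  shows "\<exists>h :: 'g \<Rightarrow> real. (\<forall>x y. h (x + y) = h x + h y) \<and> (\<forall>x\<in>F. 0 < x \<longrightarrow> L < h x)"
proof -
  interpret ordered_rat_vector_space "qmult :: rat \<Rightarrow> 'g \<Rightarrow> 'g"
    by (rule rat_vector_space)
  define F' where "F' = {x \<in> F. 0 < x}"
  have F': "finite F'"
    using assms by (simp add: F'_def)
  obtain h :: "'g \<Rightarrow> real" where h: "\<And>x y. h (x + y) = h x + h y" "\<And>x. x \<in> F' \<Longrightarrow> 0 < h x"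
    using additive_positive[OF F'] by (auto simp: F'_def)
  \<comment> \<open>The inserted \<open>1\<close> keeps the minimum defined if no element of
    \<open>F\<close> is positive.\<close>
  define e where "e = Min (insert 1 (h ` F'))"
  have "0 < e"
    using F' h(2) by (simp add: e_def)
  have e_le: "e \<le> h x" if "x \<in> F'" for x
    using F' that by (simp add: e_def)
  define s where "s = (\<bar>L\<bar> + 1) / e"
  have "0 < s" "\<bar>L\<bar> + 1 = s * e"
    using \<open>0 < e\<close> by (simp_all add: s_def)
  have "L < s * h x" if "x \<in> F'" for x
    using mult_left_mono[OF e_le[OF that], of s] \<open>0 < s\<close> \<open>\<bar>L\<bar> + 1 = s * e\<close> by linarith
  then show ?thesis
    using h(1) by (intro exI[of _ "\<lambda>x. s * h x"]) (auto simp: F'_def distrib_left)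
qed

end

section \<open>Difference constraints\<close>

text \<open>The k-fold sumset of additive combinatorics. With \<open>0 \<in> D\<close> it contains
  the shorter sums too; these finite sets delimit where \<open>h\<close> has to respect the
  order.\<close>

primrec sumset :: "'g::ab_group_add set \<Rightarrow> nat \<Rightarrow> 'g set" where
  "sumset D 0 = {0}"
| "sumset D (Suc k) = (\<lambda>(x, y). x + y) ` (D \<times> sumset D k)"

lemma finite_sumset: "finite D \<Longrightarrow> finite (sumset D k)"
  by (induction k) auto

lemma sumset_Suc_mem: "x \<in> D \<Longrightarrow> y \<in> sumset D k \<Longrightarrow> x + y \<in> sumset D (Suc k)"
  by force

lemma sumset_add: "x \<in> sumset D k \<Longrightarrow> y \<in> sumset D l \<Longrightarrow> x + y \<in> sumset D (k + l)"
proof (induction k arbitrary: x)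
  case (Suc k)
  then obtain d z where "x = d + z" "d \<in> D" "z \<in> sumset D k"
    by auto
  then show ?case
    using Suc.IH[of z] Suc.prems(2) sumset_Suc_mem[of d D "z + y" "k + l"] by (simp add: add.assoc)
qed auto

lemma sumset_1: "d \<in> D \<Longrightarrow> d \<in> sumset D 1"
  using sumset_Suc_mem[of d D 0 0] by simp

lemma zero_in_sumset: "0 \<in> D \<Longrightarrow> 0 \<in> sumset D k"
  by (induction k) force+

lemma sumset_mono: "0 \<in> D \<Longrightarrow> k \<le> l \<Longrightarrow> sumset D k \<subseteq> sumset D l"
  using sumset_add[of _ D k 0 "l - k"] zero_in_sumset[of D "l - k"] by auto

lemma sum_in_sumset: "(\<And>i. i < p \<Longrightarrow> f i \<in> D) \<Longrightarrow> (\<Sum>i<p. f i) \<in> sumset D p"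
  by (induction p) (auto simp: add.commute[of "sum _ _"] simp del: sumset.simps(2) intro: sumset_Suc_mem)

lemma uminus_in_sumset:
  "(\<And>d. d \<in> D \<Longrightarrow> - d \<in> D) \<Longrightarrow> x \<in> sumset D k \<Longrightarrow> - x \<in> sumset D k"
proof (induction k arbitrary: x)
  case (Suc k)
  then obtain d y where "x = d + y" "d \<in> D" "y \<in> sumset D k"
    by auto
  then show ?case
    using Suc sumset_Suc_mem[of "- d" D "- y" k] by (simp del: sumset.simps(2))
qed simp

lemma sumset_doubled:
  "x \<in> sumset ((\<lambda>(a, b). a + b) ` (D \<times> D)) k \<Longrightarrow> x \<in> sumset D (2 * k)"
proof (induction k arbitrary: x)
  case (Suc k)
  then obtain a b y where *: "x = (a + b) + y" "a \<in> D" "b \<in> D"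
      "y \<in> sumset ((\<lambda>(a, b). a + b) ` (D \<times> D)) k"
    by auto
  then have "a + (b + y) \<in> sumset D (Suc (Suc (2 * k)))"
    by (intro sumset_Suc_mem Suc.IH)
  then show ?case
    using * by (simp add: add.assoc)
qed simp

text \<open>
  A real solution \<open>u\<close> of a system of difference constraints, up to an error \<open>L\<close> in every constraint,
  yields an exact solution over the group. A vertex \<open>v\<close> is eliminated by
  composing the constraints that end in \<open>v\<close> with those that start in \<open>v\<close>; this doubles the error
  and the length of the sums, and the constraint \<open>y v \<le> y v + d\<close> is the reason why \<open>h\<close> has to be
  large on the positive sums.
\<close>

lemma difference_constraints:
  fixes h :: "'g::linordered_ab_group_add \<Rightarrow> real" and u :: "'v \<Rightarrow> real"
  assumes "finite V" "finite D" "0 \<in> D" "0 \<le> L"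
    and h_add: "\<And>x y. h (x + y) = h x + h y"
    and "\<And>d. d \<in> sumset D (2 ^ card V) \<Longrightarrow> d < 0 \<Longrightarrow> h d < - (2 ^ card V * L)"
  shows "\<exists>y :: 'v \<Rightarrow> 'g. \<forall>a\<in>V. \<forall>b\<in>V. \<forall>d\<in>D. u a \<le> u b + h d + L \<longrightarrow> y a \<le> y b + d"
  using assms(1-4,6)
proof (induction V arbitrary: D L rule: finite_induct)
  case (insert v V)
  define D' where "D' = (\<lambda>(a, b). a + b) ` (D \<times> D)"
  have D_D': "d \<in> D'" if "d \<in> D" for d
    using that \<open>0 \<in> D\<close> by (force simp: D'_def)
  have "\<exists>y :: 'v \<Rightarrow> 'g. \<forall>a\<in>V. \<forall>b\<in>V. \<forall>d\<in>D'. u a \<le> u b + h d + 2 * L \<longrightarrow> y a \<le> y b + d"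
  proof (rule insert.IH)
    show "finite D'" "0 \<in> D'" "0 \<le> 2 * L"
      using insert.prems D_D' by (auto simp: D'_def)
    \<comment> \<open>A sum of \<open>2 ^ card V\<close> elements of \<open>D'\<close> is a sum of
      twice as many elements of \<open>D\<close>, and the doubled error supplies the missing factor
      2, so the hypothesis on \<open>h\<close> passes to the smaller vertex set.\<close>
    show "h d < - (2 ^ card V * (2 * L))" if "d \<in> sumset D' (2 ^ card V)" "d < 0" for d
      using insert.prems(4)[of d] that sumset_doubled[of d D "2 ^ card V"] insert.hyps
      by (simp add: D'_def mult_ac)
  qed
  then obtain y :: "'v \<Rightarrow> 'g" where y: "\<And>a b d. a \<in> V \<Longrightarrow> b \<in> V \<Longrightarrow> d \<in> D' \<Longrightarrow>
      u a \<le> u b + h d + 2 * L \<Longrightarrow> y a \<le> y b + d"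
    by blast
  define lower where "lower = (\<lambda>(a, d). y a - d) ` {(a, d) \<in> V \<times> D. u a \<le> u v + h d + L}"
  define upper where "upper = (\<lambda>(b, d). y b + d) ` {(b, d) \<in> V \<times> D. u v \<le> u b + h d + L}"
  have fin: "finite lower" "finite upper"
    unfolding lower_def upper_def
    by (rule finite_imageI, rule finite_subset[of _ "V \<times> D"], use insert in auto)+
  have le: "l \<le> r" if l: "l \<in> lower" and r: "r \<in> upper" for l r
  proof -
    obtain a d where a: "l = y a - d" "a \<in> V" "d \<in> D" "u a \<le> u v + h d + L"
      using l by (auto simp: lower_def)
    obtain b e where b: "r = y b + e" "b \<in> V" "e \<in> D" "u v \<le> u b + h e + L"
      using r by (auto simp: upper_def)
    have "y a \<le> y b + (d + e)"
      using a b by (intro y) (auto simp: D'_def h_add)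
    then have "y a \<le> y b + e + d"
      by (simp add: add_ac)
    then show ?thesis
      unfolding a(1) b(1) diff_le_eq .
  qed
  \<comment> \<open>The constraints are not strict, so the largest lower bound, or else the smallest
    upper bound, can itself be the value at \<open>v\<close>.\<close>
  obtain x where x: "\<And>l. l \<in> lower \<Longrightarrow> l \<le> x" "\<And>r. r \<in> upper \<Longrightarrow> x \<le> r"
  proof (cases "lower = {}")
    case True
    show ?thesis
    proof (cases "upper = {}")
      case False
      with True fin(2) show ?thesis by (intro that[of "Min upper"]) auto
    qed (use True that in auto)
  next
    case False
    with fin le show ?thesis by (intro that[of "Max lower"]) auto
  qed
  have loop: "0 \<le> d" if "d \<in> D" "0 \<le> h d + L" for d
  proof (rule ccontr)
    assume "\<not> 0 \<le> d"
    moreover have "d \<in> sumset D (2 ^ card (insert v V))"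
      using sumset_mono[of D 1 "2 ^ card (insert v V)"] sumset_1[OF that(1)] \<open>0 \<in> D\<close> by auto
    ultimately have "h d < - (2 ^ card (insert v V) * L)"
      using insert.prems(4) by auto
    moreover have "1 * L \<le> 2 ^ card (insert v V) * L"
      using \<open>0 \<le> L\<close> by (intro mult_right_mono one_le_power) auto
    ultimately show False
      using that(2) by linarith
  qed
  have "(y(v := x)) a \<le> (y(v := x)) b + d"
    if "a \<in> insert v V" "b \<in> insert v V" "d \<in> D" "u a \<le> u b + h d + L" for a b d
  proof (cases "a = v"; cases "b = v")
    assume "a = v" "b = v"
    then show ?thesis using loop[of d] that by simp
  next
    assume "a = v" "b \<noteq> v"
    then have "y b + d \<in> upper"
      using that by (auto simp: upper_def)
    then show ?thesis using x(2) \<open>a = v\<close> \<open>b \<noteq> v\<close> by simp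
  next
    assume "a \<noteq> v" "b = v"
    then have "y a - d \<in> lower"
      using that by (auto simp: lower_def)
    then have "y a \<le> x + d"
      using x(1) by (simp flip: diff_le_eq)
    then show ?thesis using \<open>a \<noteq> v\<close> \<open>b = v\<close> by simp
  next
    assume "a \<noteq> v" "b \<noteq> v"
    then show ?thesis using y[of a b d] that D_D'[of d] \<open>0 \<le> L\<close> by simp
  qed
  then show ?case by blast
qed simp

section \<open>Tropical permanents and determinants of lifts\<close>

lemma trop_zero_le [simp]: "(0 :: 'g::linordered_ab_group_add trop) \<le> x"
  by (simp add: zero_trop_def)

lemma trop_le_zero_iff [simp]: "x \<le> 0 \<longleftrightarrow> x = (0 :: 'g::linordered_ab_group_add trop)"
  by (cases x) (simp_all add: zero_trop_def)

lemma trop_sum_le_iff: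
  fixes y :: "'g::linordered_ab_group_add trop"
  assumes "finite A"
  shows "sum f A \<le> y \<longleftrightarrow> (\<forall>a\<in>A. f a \<le> y)"
  using assms by (induction A rule: finite_induct) (auto simp: plus_trop_def)

lemma trop_le_sum:
  fixes f :: "'a \<Rightarrow> 'g::linordered_ab_group_add trop"
  assumes "finite A" "a \<in> A"
  shows "f a \<le> sum f A"
  using trop_sum_le_iff[OF assms(1), of f "sum f A"] assms(2) by simp

lemma trop_sum_attained:
  fixes f :: "'a \<Rightarrow> 'g::linordered_ab_group_add trop"
  assumes "finite A" "sum f A \<noteq> 0"
  shows "\<exists>a\<in>A. f a = sum f A"
  using assms
proof (induction A rule: finite_induct)
  case (insert x A)
  then show ?case
    by (cases "sum f A \<le> f x") (auto simp: plus_trop_def max_def)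
qed simp

lemma trop_mult_eq_0_iff [simp]:
  "x * y = 0 \<longleftrightarrow> x = 0 \<or> y = (0 :: 'g::linordered_ab_group_add trop)"
  by (cases x; cases y) (simp_all add: zero_trop_def)

primrec tval :: "'g trop \<Rightarrow> 'g::zero" where
  "tval TZero = 0"
| "tval (TVal a) = a"

lemma trop_prod_eq_TVal:
  fixes f :: "nat \<Rightarrow> 'g::linordered_ab_group_add trop"
  assumes "(\<Prod>i<p. f i) = TVal a"
  shows "(\<forall>i<p. f i \<noteq> TZero) \<and> a = (\<Sum>i<p. tval (f i))"
  using assms
proof (induction p arbitrary: a)
  case (Suc p)
  then obtain b c where "(\<Prod>i<p. f i) = TVal b" "f p = TVal c" "a = b + c"
    by (cases "\<Prod>i<p. f i"; cases "f p") auto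
  then show ?case
    using Suc.IH by (auto simp: less_Suc_eq)
qed (simp add: one_trop_def)

lemma tper_term_le:
  "q permutes {0..<dim_row W} \<Longrightarrow> tper_term W q \<le> tper W"
  unfolding tper_def by (intro trop_le_sum) (auto simp: finite_permutations)

lemma tper_attained: "\<exists>q. q permutes {0..<dim_row W} \<and> tper_term W q = tper W"
proof (cases "tper W = 0")
  case True
  then show ?thesis
    using tper_term_le[OF permutes_id, of W] permutes_id by (intro exI[of _ id]) auto
next
  case False
  then show ?thesis
    unfolding tper_def
    using trop_sum_attained[of "{p. p permutes {0..<dim_row W}}" "tper_term W"]
    by (auto simp: finite_permutations)
qed

section \<open>Exponential lifts and the dominant term of a determinant\<close>

primrec texp :: "('g \<Rightarrow> real) \<Rightarrow> 'g trop \<Rightarrow> real" where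
  "texp h TZero = 0"
| "texp h (TVal a) = exp (h a)"

lemma texp_nonneg [simp]: "0 \<le> texp h x"
  by (cases x) auto

lemma texp_zero [simp]: "texp h (0 :: 'g::linordered_ab_group_add trop) = 0"
  by (simp add: zero_trop_def)

lemma texp_pos_iff [simp]: "0 < texp h x \<longleftrightarrow> x \<noteq> (0 :: 'g::linordered_ab_group_add trop)"
  by (cases x) (auto simp: zero_trop_def)

text \<open>The slack is one-sided because \<open>lift_row\<close> corrects an entry only by
  enlarging it. A tropical zero can only lift to the real zero.\<close>

definition lifts :: "('g \<Rightarrow> real) \<Rightarrow> real \<Rightarrow> 'g signed_trop \<Rightarrow> real \<Rightarrow> bool" where
  "lifts h U x r \<longleftrightarrow> sgn r = of_int (trop_sign x) \<and>
     texp h (modulus x) \<le> \<bar>r\<bar> \<and> \<bar>r\<bar> \<le> U * texp h (modulus x)"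

lemma of_int_det_sign: "of_int (det_sign R) = sgn (det R)"
  by (simp add: det_sign_def sgn_real_def)

locale real_hom =
  fixes h :: "'g::linordered_ab_group_add \<Rightarrow> real"
  assumes h_add: "h (x + y) = h x + h y"
begin

lemma h_zero [simp]: "h 0 = 0"
  using h_add[of 0 0] by simp

lemma h_minus: "h (- x) = - h x"
  using h_add[of x "- x"] by simp

lemma h_diff: "h (x - y) = h x - h y"
  using h_add[of x "- y"] by (simp add: h_minus)

lemma texp_mult: "texp h (x * y) = texp h x * texp h y"
  by (cases x; cases y) (simp_all add: h_add exp_add)

lemma texp_one [simp]: "texp h 1 = 1"
  by (simp add: one_trop_def)

lemma texp_prod: "texp h (prod f A) = (\<Prod>a\<in>A. texp h (f a))"
  by (induction A rule: infinite_finite_induct) (simp_all add: texp_mult)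

lemma prod_lifts_bounds:
  assumes "\<And>i. i \<in> A \<Longrightarrow> lifts h U (w i) (r i)"
  shows "texp h (\<Prod>i\<in>A. modulus (w i)) \<le> \<bar>\<Prod>i\<in>A. r i\<bar>"
    and "\<bar>\<Prod>i\<in>A. r i\<bar> \<le> U ^ card A * texp h (\<Prod>i\<in>A. modulus (w i))"
proof -
  show "texp h (\<Prod>i\<in>A. modulus (w i)) \<le> \<bar>\<Prod>i\<in>A. r i\<bar>"
    unfolding texp_prod abs_prod using assms by (intro prod_mono) (auto simp: lifts_def)
  have "\<bar>\<Prod>i\<in>A. r i\<bar> \<le> (\<Prod>i\<in>A. U * texp h (modulus (w i)))"
    unfolding abs_prod using assms by (intro prod_mono) (auto simp: lifts_def)
  then show "\<bar>\<Prod>i\<in>A. r i\<bar> \<le> U ^ card A * texp h (\<Prod>i\<in>A. modulus (w i))"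
    by (simp add: texp_prod prod.distrib)
qed

text \<open>The Leibniz expansion has \<open>fact p\<close> terms, and \<open>U ^ p\<close> is the
  slack of a product of p entries. Under \<open>gap\<close> each non-maximal term is at most
  \<open>t / fact p\<close>, where \<open>t\<close> bounds the maximal one from below, so the other
  \<open>fact p - 1\<close> terms together cannot reverse its sign. If the permanent is zero, all
  terms vanish.\<close>

lemma det_sign_lift:
  assumes W: "W \<in> carrier_mat p p" and R: "R \<in> carrier_mat p p"
    and lift: "\<And>i j. i < p \<Longrightarrow> j < p \<Longrightarrow> lifts h U (W $$ (i, j)) (R $$ (i, j))"
    and regular: "tper W = 0 \<or> trop_nonsingular W"
    and gap: "\<And>q. q permutes {0..<p} \<Longrightarrow> tper_term W q \<noteq> tper W \<Longrightarrow>
      fact p * U ^ p * texp h (tper_term W q) < texp h (tper W)"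
  shows "det_sign R = tper_sign W"
proof -
  define T where "T q = of_int (sign q) * (\<Prod>i = 0..<p. R $$ (i, q i))" for q :: "nat \<Rightarrow> nat"
  define P where "P = {q. q permutes {0..<p}}"
  have fin: "finite P"
    by (simp add: P_def finite_permutations)
  have det: "det R = (\<Sum>q\<in>P. T q)"
    unfolding T_def P_def by (rule det_def'[OF R])
  have perm_lift: "lifts h U (W $$ (i, q i)) (R $$ (i, q i))" if "q \<in> P" "i \<in> {0..<p}" for q i
    using that permutes_in_image[of q "{0..<p}" i] by (intro lift) (auto simp: P_def)
  have abs_T: "\<bar>T q\<bar> = \<bar>\<Prod>i = 0..<p. R $$ (i, q i)\<bar>" for q
    by (simp add: T_def abs_mult sign_def)
  have lower: "texp h (tper_term W q) \<le> \<bar>T q\<bar>"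
    and upper: "\<bar>T q\<bar> \<le> U ^ p * texp h (tper_term W q)" if "q \<in> P" for q
    using prod_lifts_bounds[of "{0..<p}" U "\<lambda>i. W $$ (i, q i)" "\<lambda>i. R $$ (i, q i)"]
      perm_lift[OF that] W by (simp_all add: abs_T tper_term_def)
  show ?thesis
  proof (cases "tper W = 0")
    case True
    have "T q = 0" if "q \<in> P" for q
      using upper[OF that] tper_term_le[of q W] that W True by (simp add: P_def)
    then have "det R = 0"
      by (simp add: det)
    then show ?thesis
      using True by (simp add: tper_sign_def det_sign_def)
  next
    case False
    then obtain s where s: "s permutes {0..<dim_row W}" "tper_term W s = tper W"
      and uniq: "\<And>q. q permutes {0..<dim_row W} \<Longrightarrow> tper_term W q = tper W \<Longrightarrow> q = s"
      using regular unfolding trop_nonsingular_def by blast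
    have the_s: "(THE p. p permutes {0..<dim_row W} \<and> tper_term W p = tper W) = s"
      using s uniq by blast
    have "s \<in> P"
      using s W by (simp add: P_def)
    define t where "t = texp h (tper W)"
    have "0 < t"
      using False by (simp add: t_def)
    have other: "\<bar>T q\<bar> \<le> t / fact p" if "q \<in> P - {s}" for q
    proof -
      have "tper_term W q \<noteq> tper W"
        using uniq[of q] that W by (auto simp: P_def)
      then have "fact p * U ^ p * texp h (tper_term W q) < t"
        unfolding t_def using that by (intro gap) (auto simp: P_def)
      then have "U ^ p * texp h (tper_term W q) < t / fact p"
        by (simp add: field_simps)
      then show ?thesis
        using upper[of q] that by simp
    qed
    have cardP: "card P = fact p"
      unfolding P_def by (rule card_permutations) auto
    have "\<bar>\<Sum>q\<in>P - {s}. T q\<bar> \<le> (\<Sum>q\<in>P - {s}. \<bar>T q\<bar>)"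
      by (rule sum_abs)
    also have "\<dots> \<le> (\<Sum>q\<in>P - {s}. t / fact p)"
      by (intro sum_mono other)
    also have "\<dots> = real (card (P - {s})) * (t / fact p)"
      by simp
    also have "\<dots> = (fact p - 1) * (t / fact p)"
      using fin \<open>s \<in> P\<close> cardP by (simp add: of_nat_diff fact_ge_1)
    also have "\<dots> < t"
      using \<open>0 < t\<close> by (simp add: field_simps)
    also have "t \<le> \<bar>T s\<bar>"
      using lower[OF \<open>s \<in> P\<close>] s by (simp add: t_def)
    finally have small: "\<bar>\<Sum>q\<in>P - {s}. T q\<bar> < \<bar>T s\<bar>" .
    have "det R = T s + (\<Sum>q\<in>P - {s}. T q)"
      using fin \<open>s \<in> P\<close> by (simp add: det sum.remove)
    then have "sgn (det R) = sgn (T s)"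
      using small by (auto simp: sgn_real_def)
    also have "\<dots> = of_int (sign s) * (\<Prod>i = 0..<p. sgn (R $$ (i, s i)))"
    proof -
      have "sgn (prod f A) = (\<Prod>i\<in>A. sgn (f i))" for f :: "nat \<Rightarrow> real" and A
        by (induction A rule: infinite_finite_induct) (simp_all add: sgn_mult)
      then show ?thesis
        by (simp add: T_def sgn_mult sign_def)
    qed
    also have "(\<Prod>i = 0..<p. sgn (R $$ (i, s i))) =
        (\<Prod>i = 0..<p. of_int (trop_sign (W $$ (i, s i))))"
      using perm_lift[OF \<open>s \<in> P\<close>] by (intro prod.cong) (auto simp: lifts_def)
    finally have "sgn (det R) = of_int (tper_sign W)"
      unfolding tper_sign_def the_s Let_def using False W by simp
    then show ?thesis
      by (simp flip: of_int_det_sign)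
  qed
qed

text \<open>The exponent of a non-zero term is a sum of p elements of \<open>E\<close>, so the gap
  between two terms is a sum of p differences. This replaces a condition on every matrix by one on a
  finite set depending only on \<open>E\<close> and p.\<close>

lemma det_sign_lift_dominant:
  assumes W: "W \<in> carrier_mat p p" and R: "R \<in> carrier_mat p p"
    and lift: "\<And>i j. i < p \<Longrightarrow> j < p \<Longrightarrow> lifts h U (W $$ (i, j)) (R $$ (i, j))"
    and regular: "tper W = 0 \<or> trop_nonsingular W"
    and E: "\<And>i j a. i < p \<Longrightarrow> j < p \<Longrightarrow> modulus (W $$ (i, j)) = TVal a \<Longrightarrow> a \<in> E"
    and large: "\<And>x. x \<in> sumset {a - b | a b. a \<in> E \<and> b \<in> E} p \<Longrightarrow> 0 < x \<Longrightarrow>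
      fact p * U ^ p < exp (h x)"
  shows "det_sign R = tper_sign W"
proof (rule det_sign_lift[OF W R lift regular])
  fix q assume q: "q permutes {0..<p}" "tper_term W q \<noteq> tper W"
  then have less: "tper_term W q < tper W"
    using tper_term_le[of q W] W by auto
  then obtain a where a: "tper W = TVal a"
    by (cases "tper W") (auto simp: less_trop_def)
  show "fact p * U ^ p * texp h (tper_term W q) < texp h (tper W)"
  proof (cases "tper_term W q")
    case TZero
    then show ?thesis using a by simp
  next
    case (TVal b)
    have term_prod: "(\<Prod>i<p. modulus (W $$ (i, r i))) = tper_term W r" for r
      using W by (simp add: tper_term_def atLeast0LessThan)
    have sum_E: "\<exists>f. (\<forall>i<p. f i \<in> E) \<and> c = (\<Sum>i<p. f i)"
      if r: "r permutes {0..<p}" "tper_term W r = TVal c" for r c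
    proof -
      have *: "(\<forall>i<p. modulus (W $$ (i, r i)) \<noteq> TZero) \<and>
          c = (\<Sum>i<p. tval (modulus (W $$ (i, r i))))"
        using r(2) by (intro trop_prod_eq_TVal) (simp add: term_prod)
      have "tval (modulus (W $$ (i, r i))) \<in> E" if "i < p" for i
        using * E[OF that, of "r i"] that permutes_in_image[OF r(1), of i]
        by (cases "modulus (W $$ (i, r i))") auto
      with * show ?thesis
        by (intro exI[of _ "\<lambda>i. tval (modulus (W $$ (i, r i)))"]) simp
    qed
    obtain s where "s permutes {0..<dim_row W}" "tper_term W s = tper W"
      using tper_attained by blast
    then have "s permutes {0..<p}" "tper_term W s = TVal a"
      using a W by simp_all
    then obtain f where f: "\<forall>i<p. f i \<in> E" "a = (\<Sum>i<p. f i)"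
      using sum_E[of s a] by blast
    obtain g where g: "\<forall>i<p. g i \<in> E" "b = (\<Sum>i<p. g i)"
      using sum_E[of q b] q(1) TVal by blast
    have "(\<Sum>i<p. f i - g i) \<in> sumset {a - b | a b. a \<in> E \<and> b \<in> E} p"
      using f g by (intro sum_in_sumset) blast
    then have "a - b \<in> sumset {a - b | a b. a \<in> E \<and> b \<in> E} p"
      using f g by (simp add: sum_subtractf)
    moreover have "0 < a - b"
      using less a TVal by (auto simp: less_trop_def)
    ultimately have "fact p * U ^ p < exp (h (a - b))"
      by (rule large)
    then have "fact p * U ^ p * exp (h b) < exp (h (a - b)) * exp (h b)"
      by simp
    then show ?thesis
      by (simp add: a TVal h_diff flip: exp_add)
  qed
qed

end

section \<open>Submatrices given by lists of indices\<close>

text \<open>Lists keep an order of rows and columns, whereas \<open>submatrix\<close> always takes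
  increasing indices. The order matters for the sign of a determinant when Cramer's rule or a
  reduced cost replaces a line in place.\<close>

definition selmat :: "(nat \<times> nat \<Rightarrow> 'a) \<Rightarrow> nat list \<Rightarrow> nat list \<Rightarrow> 'a mat" where
  "selmat f rs cs = mat (length rs) (length cs) (\<lambda>(i, j). f (rs ! i, cs ! j))"

lemma selmat_carrier [simp]: "selmat f rs cs \<in> carrier_mat (length rs) (length cs)"
  and dim_row_selmat [simp]: "dim_row (selmat f rs cs) = length rs"
  and dim_col_selmat [simp]: "dim_col (selmat f rs cs) = length cs"
  and selmat_index [simp]: "i < length rs \<Longrightarrow> j < length cs \<Longrightarrow>
    selmat f rs cs $$ (i, j) = f (rs ! i, cs ! j)"
  by (simp_all add: selmat_def)

definition indices :: "nat set \<Rightarrow> nat list" where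
  "indices I = map (pick I) [0..<card I]"

lemma length_indices [simp]: "length (indices I) = card I"
  by (simp add: indices_def)

lemma distinct_indices [simp]: "distinct (indices I)"
  unfolding indices_def distinct_map
  using card_pick_le[of _ I] by (auto intro!: inj_onI) metis

lemma set_indices [simp]: "finite I \<Longrightarrow> set (indices I) = I"
proof (rule card_subset_eq)
  assume "finite I"
  then show "set (indices I) \<subseteq> I"
    by (auto simp: indices_def pick_in_set_le)
  show "card (set (indices I)) = card I"
    using distinct_card[OF distinct_indices, of I] by simp
qed

lemma submatrix_eq_selmat:
  assumes "I \<subseteq> {..<dim_row M}" "J \<subseteq> {..<dim_col M}"
  shows "submatrix M I J = selmat (($$) M) (indices I) (indices J)"
proof -
  have "{i. i < dim_row M \<and> i \<in> I} = I" "{j. j < dim_col M \<and> j \<in> J} = J"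
    using assms by auto
  then show ?thesis
    by (intro eq_matI) (simp_all add: submatrix_def indices_def)
qed

lemma submatrix_UNIV_eq_selmat:
  assumes "I \<subseteq> {..<dim_row M}"
  shows "submatrix M I UNIV = selmat (($$) M) (indices I) [0..<dim_col M]"
proof -
  have "{i. i < dim_row M \<and> i \<in> I} = I"
    using assms by auto
  then show ?thesis
    by (intro eq_matI) (simp_all add: submatrix_def indices_def pick_UNIV)
qed

text \<open>Reordering by \<open>\<alpha>\<close> and \<open>\<beta>\<close> carries the term of q
  to the term of \<open>\<Phi> q\<close>. As \<open>\<Phi>\<close> is a bijection of permutations,
  the maximum and the number of terms attaining it stay the same.\<close>

lemma regular_selmat_reorder:
  fixes f :: "nat \<times> nat \<Rightarrow> 'g::linordered_ab_group_add signed_trop"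
  assumes rs: "mset rs = mset rs'" and cs: "mset cs = mset cs'" and len: "length rs = length cs"
    and regular: "tper (selmat f rs' cs') = 0 \<or> trop_nonsingular (selmat f rs' cs')"
  shows "tper (selmat f rs cs) = 0 \<or> trop_nonsingular (selmat f rs cs)"
proof -
  define p where "p = length rs"
  have lens: "length rs = p" "length cs = p" "length rs' = p" "length cs' = p"
    using len mset_eq_length[OF rs] mset_eq_length[OF cs] by (simp_all add: p_def)
  let ?W = "selmat f rs cs" and ?W' = "selmat f rs' cs'"
  obtain \<alpha> where \<alpha>: "\<alpha> permutes {0..<p}" "permute_list \<alpha> rs' = rs"
    using mset_eq_permutation[OF rs] lens by (metis atLeast0LessThan)
  obtain \<beta> where \<beta>: "\<beta> permutes {0..<p}" "permute_list \<beta> cs' = cs"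
    using mset_eq_permutation[OF cs] lens by (metis atLeast0LessThan)
  have rs_nth: "rs ! i = rs' ! \<alpha> i" and cs_nth: "cs ! i = cs' ! \<beta> i" if "i < p" for i
    using that \<alpha>(2) \<beta>(2) lens by (auto simp: permute_list_def)
  have in_range: "\<pi> i < p" if "\<pi> permutes {0..<p}" "i < p" for \<pi> i
    using permutes_in_image[OF that(1), of i] that(2) by simp
  define \<Phi> where "\<Phi> q = \<beta> \<circ> q \<circ> inv_into UNIV \<alpha>" for q :: "nat \<Rightarrow> nat"
  have \<Phi>_perm: "\<Phi> q permutes {0..<p}" if "q permutes {0..<p}" for q
    unfolding \<Phi>_def using that \<alpha>(1) \<beta>(1) by (intro permutes_compose permutes_inv)
  have \<Phi>_inj: "q = r" if "\<Phi> q = \<Phi> r" for q r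
  proof -
    have "inv_into UNIV \<beta> \<circ> \<Phi> q \<circ> \<alpha> = inv_into UNIV \<beta> \<circ> \<Phi> r \<circ> \<alpha>"
      by (simp add: that)
    moreover have "inv_into UNIV \<beta> \<circ> \<Phi> s \<circ> \<alpha> = s" for s
      using permutes_inverses[OF \<alpha>(1)] permutes_inverses[OF \<beta>(1)] by (simp add: \<Phi>_def fun_eq_iff)
    ultimately show ?thesis by metis
  qed
  have \<Phi>_bij: "bij_betw \<Phi> {q. q permutes {0..<p}} {q. q permutes {0..<p}}"
    unfolding bij_betw_def
  proof
    show inj: "inj_on \<Phi> {q. q permutes {0..<p}}"
      using \<Phi>_inj by (intro inj_onI)
    show "\<Phi> ` {q. q permutes {0..<p}} = {q. q permutes {0..<p}}"
      using \<Phi>_perm inj by (intro endo_inj_surj) (auto simp: finite_permutations)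
  qed
  have term_eq: "tper_term ?W q = tper_term ?W' (\<Phi> q)" if q: "q permutes {0..<p}" for q
  proof -
    have "tper_term ?W q = (\<Prod>i = 0..<p. modulus (f (rs' ! \<alpha> i, cs' ! \<beta> (q i))))"
      using in_range[OF q] by (simp add: tper_term_def lens rs_nth cs_nth)
    also have "\<dots> = (\<Prod>i = 0..<p. modulus (f (rs' ! \<alpha> i, cs' ! \<Phi> q (\<alpha> i))))"
      using permutes_inverses(2)[OF \<alpha>(1)] by (simp add: \<Phi>_def)
    also have "\<dots> = (\<Prod>i = 0..<p. modulus (f (rs' ! i, cs' ! \<Phi> q i)))"
      using permutes_imp_bij[OF \<alpha>(1)]
      by (rule prod.reindex_bij_betw[where g = "\<lambda>i. modulus (f (rs' ! i, cs' ! \<Phi> q i))"])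
    also have "\<dots> = tper_term ?W' (\<Phi> q)"
      using in_range[OF \<Phi>_perm[OF q]] by (simp add: tper_term_def lens)
    finally show ?thesis .
  qed
  have tper_eq: "tper ?W = tper ?W'"
    unfolding tper_def
    using sum.reindex_bij_betw[OF \<Phi>_bij, of "tper_term ?W'"] by (simp add: lens term_eq)
  show ?thesis
  proof (cases "tper ?W = 0")
    case False
    then have nonsing: "trop_nonsingular ?W'"
      using regular tper_eq by simp
    have "q = r" if "q permutes {0..<p}" "tper_term ?W q = tper ?W"
      "r permutes {0..<p}" "tper_term ?W r = tper ?W" for q r
      using that nonsing \<Phi>_perm[of q] \<Phi>_perm[of r] \<Phi>_inj[of q r]
      unfolding trop_nonsingular_def by (simp add: lens term_eq tper_eq) metis
    then show ?thesis
      using False tper_attained[of ?W] unfolding trop_nonsingular_def by (auto simp: lens)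
  qed simp
qed

text \<open>Genericity speaks of increasing indices; here it becomes available for the unsorted
  lists of Cramer's rule and of reduced costs.\<close>

lemma trop_generic_selmat:
  assumes "trop_generic M" "distinct rs" "distinct cs" "length rs = length cs"
    and "set rs \<subseteq> {..<dim_row M}" "set cs \<subseteq> {..<dim_col M}"
  shows "tper (selmat (($$) M) rs cs) = 0 \<or> trop_nonsingular (selmat (($$) M) rs cs)"
proof (rule regular_selmat_reorder)
  have card: "card (set rs) = card (set cs)"
    using assms(2-4) by (simp add: distinct_card)
  show "mset rs = mset (indices (set rs))" "mset cs = mset (indices (set cs))"
    using assms(2,3) by (simp_all flip: set_eq_iff_mset_eq_distinct)
  show "tper (selmat (($$) M) (indices (set rs)) (indices (set cs))) = 0 \<or>
      trop_nonsingular (selmat (($$) M) (indices (set rs)) (indices (set cs)))"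
    using assms(1,5,6) card unfolding trop_generic_def Let_def
    by (metis submatrix_eq_selmat)
qed (fact assms(4))

section \<open>Bases and signs of minors\<close>

definition aug :: "'a mat \<Rightarrow> 'a vec \<Rightarrow> nat \<times> nat \<Rightarrow> 'a" where
  "aug A b = (\<lambda>(i, j). if j < dim_col A then A $$ (i, j) else b $ i)"

text \<open>Homogeneous coordinates (x, 1). With \<open>aug\<close> they turn the constraints into
  linear forms in n + 1 coordinates, over the reals and over the tropical semiring alike.\<close>

definition hom_coord :: "'a::one vec \<Rightarrow> nat \<Rightarrow> 'a" where
  "hom_coord x j = (if j < dim_vec x then x $ j else 1)"

lemma mult_mat_vec_add_index:
  fixes A :: "'a::comm_semiring_1 mat"
  assumes "A \<in> carrier_mat m n" "b \<in> carrier_vec m" "x \<in> carrier_vec n" "i < m"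
  shows "(A *\<^sub>v x + b) $ i = (\<Sum>j<Suc n. aug A b (i, j) * hom_coord x j)"
  using assms by (simp add: aug_def hom_coord_def scalar_prod_def atLeast0LessThan)

lemma row_add_index:
  fixes A :: "'a::comm_semiring_1 mat"
  assumes "A \<in> carrier_mat m n" "b \<in> carrier_vec m" "x \<in> carrier_vec n" "i < m"
  shows "row A i \<bullet> x + b $ i = (\<Sum>j<Suc n. aug A b (i, j) * hom_coord x j)"
  using mult_mat_vec_add_index[OF assms] assms by simp

lemma mem_polyhedron_iff:
  assumes "A \<in> carrier_mat m n" "b \<in> carrier_vec m"
  shows "x \<in> polyhedron A b \<longleftrightarrow> x \<in> carrier_vec n \<and> (\<forall>j<n. 0 \<le> x $ j) \<and>
    (\<forall>i<m. 0 \<le> (\<Sum>j<Suc n. aug A b (i, j) * hom_coord x j))"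
proof (cases "x \<in> carrier_vec n")
  case True
  have "0 \<le> (A *\<^sub>v x + b) $ i \<longleftrightarrow> 0 \<le> (\<Sum>j<Suc n. aug A b (i, j) * hom_coord x j)" if "i < m" for i
    by (simp only: mult_mat_vec_add_index[OF assms True that])
  then show ?thesis
    using assms True by (auto simp: polyhedron_def less_eq_vec_def)
qed (use assms in \<open>auto simp: polyhedron_def\<close>)

lemma mem_trop_polyhedron_iff:
  assumes "A \<in> carrier_mat m n" "b \<in> carrier_vec m"
  shows "x \<in> trop_polyhedron A b \<longleftrightarrow> x \<in> carrier_vec n \<and>
    (\<forall>i<m. (\<Sum>j<Suc n. neg_part (aug A b (i, j)) * hom_coord x j)
      \<le> (\<Sum>j<Suc n. pos_part (aug A b (i, j)) * hom_coord x j))"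
    and "x \<in> carrier_vec n \<Longrightarrow> i < m \<Longrightarrow> trop_lhs A b x $ i =
      (\<Sum>j<Suc n. pos_part (aug A b (i, j)) * hom_coord x j)"
    and "x \<in> carrier_vec n \<Longrightarrow> i < m \<Longrightarrow> trop_rhs A b x $ i =
      (\<Sum>j<Suc n. neg_part (aug A b (i, j)) * hom_coord x j)"
proof -
  show lhs: "trop_lhs A b x $ i = (\<Sum>j<Suc n. pos_part (aug A b (i, j)) * hom_coord x j)"
    if "x \<in> carrier_vec n" "i < m" for i
    using assms that
    by (subst mult_mat_vec_add_index[where m = m and n = n]) (auto simp: aug_def intro!: sum.cong)
  show rhs: "trop_rhs A b x $ i = (\<Sum>j<Suc n. neg_part (aug A b (i, j)) * hom_coord x j)"
    if "x \<in> carrier_vec n" "i < m" for i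
    using assms that
    by (subst mult_mat_vec_add_index[where m = m and n = n]) (auto simp: aug_def intro!: sum.cong)
  show "x \<in> trop_polyhedron A b \<longleftrightarrow> x \<in> carrier_vec n \<and>
    (\<forall>i<m. (\<Sum>j<Suc n. neg_part (aug A b (i, j)) * hom_coord x j)
      \<le> (\<Sum>j<Suc n. pos_part (aug A b (i, j)) * hom_coord x j))"
  proof (cases "x \<in> carrier_vec n")
    case True
    have "trop_rhs A b x \<le> trop_lhs A b x \<longleftrightarrow> (\<forall>i<m. trop_rhs A b x $ i \<le> trop_lhs A b x $ i)"
      using assms by (simp add: less_eq_vec_def)
    also have "\<dots> \<longleftrightarrow> (\<forall>i<m. (\<Sum>j<Suc n. neg_part (aug A b (i, j)) * hom_coord x j)
        \<le> (\<Sum>j<Suc n. pos_part (aug A b (i, j)) * hom_coord x j))"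
      by (intro all_cong1 imp_cong refl) (simp only: lhs[OF True] rhs[OF True])
    finally show ?thesis
      using assms True by (simp add: trop_polyhedron_def)
  qed (use assms in \<open>auto simp: trop_polyhedron_def\<close>)
qed

section \<open>Coordinates and slacks of a basic point as quotients of minors\<close>

lemma solve_linear_system:
  fixes B :: "'a::field mat"
  assumes "B \<in> carrier_mat n n" "det B \<noteq> 0" "y \<in> carrier_vec n"
  obtains x where "x \<in> carrier_vec n" "B *\<^sub>v x = y"
proof
  let ?x = "inverse (det B) \<cdot>\<^sub>v (adj_mat B *\<^sub>v y)"
  have adj: "adj_mat B \<in> carrier_mat n n"
    using adj_mat(1)[OF assms(1)] .
  show "?x \<in> carrier_vec n"
    using adj assms by auto
  have "B *\<^sub>v ?x = inverse (det B) \<cdot>\<^sub>v (B *\<^sub>v (adj_mat B *\<^sub>v y))"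
    using adj assms by (intro mult_mat_vec) auto
  also have "B *\<^sub>v (adj_mat B *\<^sub>v y) = (B * adj_mat B) *\<^sub>v y"
    using adj assms by (intro assoc_mult_mat_vec[symmetric]) auto
  also have "B * adj_mat B = det B \<cdot>\<^sub>m 1\<^sub>m n"
    using adj_mat(2)[OF assms(1)] .
  also have "\<dots> *\<^sub>v y = det B \<cdot>\<^sub>v y"
    using assms by auto
  also have "inverse (det B) \<cdot>\<^sub>v \<dots> = y"
    using assms by (simp add: smult_smult_assoc)
  finally show "B *\<^sub>v ?x = y" .
qed

context
  fixes A :: "'a::field mat" and b x :: "'a vec" and I :: "nat set" and m n :: nat
  assumes A: "A \<in> carrier_mat m n" and b: "b \<in> carrier_vec m" and x: "x \<in> carrier_vec n"
    and I: "I \<subseteq> {..<m}" "card I = n"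
    and tight: "\<And>i. i \<in> I \<Longrightarrow> (\<Sum>j<Suc n. aug A b (i, j) * hom_coord x j) = 0"
begin

text \<open>Cramer's rule for the tight equations with the constants moved to the right. The column
  of constants is put in place j, so the only sign is that of the right-hand side.\<close>

lemma cramer_coordinate:
  assumes "j < n"
  shows "det (selmat (aug A b) (indices I) ([0..<n][j := n])) =
    - x $ j * det (selmat (aug A b) (indices I) [0..<n])"
proof -
  let ?B = "selmat (aug A b) (indices I) [0..<n]"
  have B: "?B \<in> carrier_mat n n"
    using selmat_carrier[of "aug A b" "indices I" "[0..<n]"] I by simp
  have mem: "indices I ! i \<in> I" if "i < n" for i
    using that I finite_subset[OF I(1)] nth_mem[of i "indices I"] by simp
  have "selmat (aug A b) (indices I) ([0..<n][j := n]) = replace_col ?B (?B *\<^sub>v (- x)) j"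
  proof (rule eq_matI)
    fix i k
    assume "i < dim_row (replace_col ?B (?B *\<^sub>v (- x)) j)"
      "k < dim_col (replace_col ?B (?B *\<^sub>v (- x)) j)"
    then have ik: "i < n" "k < n"
      using I by (simp_all add: replace_col_def)
    have "(?B *\<^sub>v (- x)) $ i = - (\<Sum>l<n. aug A b (indices I ! i, l) * x $ l)"
      using ik I x by (simp add: scalar_prod_def atLeast0LessThan sum_negf)
    also have "\<dots> = aug A b (indices I ! i, n)"
      using tight[OF mem[OF ik(1)]] x by (intro minus_unique) (simp add: hom_coord_def)
    finally show "selmat (aug A b) (indices I) ([0..<n][j := n]) $$ (i, k) =
        replace_col ?B (?B *\<^sub>v (- x)) j $$ (i, k)"
      using ik I by (simp add: replace_col_def nth_list_update)
  qed (use I in \<open>simp_all add: replace_col_def\<close>)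
  also have "det \<dots> = (- x) $ j * det ?B"
    using B x assms by (intro cramer_lemma_mat) auto
  finally show ?thesis
    using assms x by simp
qed

text \<open>Replacing the last column by the combination of all columns with coefficients (x, 1)
  preserves the determinant, since the last coefficient is 1. The new column vanishes in the rows of
  \<open>I\<close> and holds the slack of row k at the bottom; expanding along it leaves one
  minor.\<close>

lemma cramer_slack:
  "det (selmat (aug A b) (indices I @ [k]) [0..<Suc n]) =
    (\<Sum>j<Suc n. aug A b (k, j) * hom_coord x j) * det (selmat (aug A b) (indices I) [0..<n])"
proof -
  let ?C = "selmat (aug A b) (indices I @ [k]) [0..<Suc n]"
  let ?s = "\<Sum>j<Suc n. aug A b (k, j) * hom_coord x j"
  define v where "v = vec (Suc n) (hom_coord x)"
  have C: "?C \<in> carrier_mat (Suc n) (Suc n)"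
    using selmat_carrier[of "aug A b" "indices I @ [k]" "[0..<Suc n]"] I by simp
  have v: "v \<in> carrier_vec (Suc n)" "v $ n = 1"
    using x by (simp_all add: v_def hom_coord_def)
  have mem: "indices I ! i \<in> I" if "i < n" for i
    using that I finite_subset[OF I(1)] nth_mem[of i "indices I"] by simp
  have Cv: "(?C *\<^sub>v v) $ i = (if i < n then 0 else ?s)" if "i < Suc n" for i
  proof -
    have "(?C *\<^sub>v v) $ i = (\<Sum>j<Suc n. aug A b ((indices I @ [k]) ! i, j) * hom_coord x j)"
      using that I
      by (auto simp: v_def scalar_prod_def atLeast0LessThan nth_append simp del: upt_Suc
          intro!: sum.cong)
    then show ?thesis
      using that I mem tight by (cases "i < n") (auto simp: nth_append less_Suc_eq)
  qed
  let ?R = "replace_col ?C (?C *\<^sub>v v) n"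
  have R: "?R \<in> carrier_mat (Suc n) (Suc n)"
    using C I by (simp add: replace_col_def del: upt_Suc)
  have "det ?C = det ?R"
    using cramer_lemma_mat[OF C v(1), of n] v(2) by simp
  also have "det ?R = (\<Sum>i<Suc n. ?R $$ (i, n) * cofactor ?R i n)"
    using laplace_expansion_column[OF R] by simp
  also have "\<dots> = ?s * cofactor ?R n n"
    using I Cv by (simp add: replace_col_def del: upt_Suc sum.lessThan_Suc) 
        (simp add: sum.lessThan_Suc[of _ n] del: upt_Suc)
  also have "mat_delete ?R n n = selmat (aug A b) (indices I) [0..<n]"
    using I by (intro eq_matI) (auto simp: mat_delete_def replace_col_def nth_append simp del: upt_Suc)
  then have "cofactor ?R n n = det (selmat (aug A b) (indices I) [0..<n])"
    by (simp add: cofactor_def flip: mult_2)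
  finally show ?thesis .
qed

end

lemma submatrix_eq_selmat_aug:
  assumes "A \<in> carrier_mat m n" "I \<subseteq> {..<m}" "card I = n"
  shows "submatrix A I UNIV = selmat (aug A b) (indices I) [0..<n]"
  using assms submatrix_UNIV_eq_selmat[of I A]
  by (auto simp: aug_def intro!: eq_matI)

lemma lp_basis_cong_signs:
  assumes A: "A \<in> carrier_mat m n" "A' \<in> carrier_mat m n"
    and b: "b \<in> carrier_vec m" "b' \<in> carrier_vec m"
    and signs: "\<And>rs cs. distinct rs \<Longrightarrow> distinct cs \<Longrightarrow> set rs \<subseteq> {..<m} \<Longrightarrow> set cs \<subseteq> {..n} \<Longrightarrow>
      length rs = length cs \<Longrightarrow>
      det_sign (selmat (aug A b) rs cs) = det_sign (selmat (aug A' b') rs cs)"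
    and basis: "lp_basis A b I"
  shows "lp_basis A' b' I"
proof -
  have I: "I \<subseteq> {..<m}" "card I = n"
    using basis A by (simp_all add: lp_basis_def)
  have finI: "finite I"
    using I(1) finite_subset by blast
  let ?B = "selmat (aug A b) (indices I) [0..<n]"
  let ?B' = "selmat (aug A' b') (indices I) [0..<n]"
  have sgn_det: "sgn (det (selmat (aug A b) rs cs)) = sgn (det (selmat (aug A' b') rs cs))"
    if "distinct rs" "distinct cs" "set rs \<subseteq> {..<m}" "set cs \<subseteq> {..n}" "length rs = length cs" for rs cs
    using signs[OF that] by (simp flip: of_int_det_sign)
  have sgn_B: "sgn (det ?B) = sgn (det ?B')"
    using I finI by (intro sgn_det) auto
  have det_B: "det ?B \<noteq> 0"
    using basis submatrix_eq_selmat_aug[OF A(1) I] by (simp add: lp_basis_def)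
  then have det_B': "det ?B' \<noteq> 0"
    using sgn_B by (metis sgn_0_0)
  obtain x where x: "x \<in> polyhedron A b" "\<And>i. i \<in> I \<Longrightarrow> row A i \<bullet> x + b $ i = 0"
    using basis by (auto simp: lp_basis_def)
  note x_poly = x(1)[unfolded mem_polyhedron_iff[OF A(1) b(1)]]
  have x_carrier: "x \<in> carrier_vec n"
    using x_poly by simp
  have x_tight: "(\<Sum>j<Suc n. aug A b (i, j) * hom_coord x j) = 0" if "i \<in> I" for i
    using x(2)[OF that] row_add_index[OF A(1) b(1) x_carrier, of i] I that by auto
  have mem: "indices I ! i \<in> I" if "i < n" for i
    using that I finI nth_mem[of i "indices I"] by simp
  have B': "?B' \<in> carrier_mat n n"
    using selmat_carrier[of "aug A' b'" "indices I" "[0..<n]"] I by simp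
  obtain x' where x': "x' \<in> carrier_vec n" "?B' *\<^sub>v x' = vec n (\<lambda>i. - b' $ (indices I ! i))"
    using solve_linear_system[OF B' det_B', of "vec n (\<lambda>i. - b' $ (indices I ! i))"] by auto
  have x'_tight: "(\<Sum>j<Suc n. aug A' b' (i, j) * hom_coord x' j) = 0" if i: "i \<in> I" for i
  proof -
    obtain k where k: "k < n" "i = indices I ! k"
      using i finI I by (metis in_set_conv_nth length_indices set_indices)
    have "(?B' *\<^sub>v x') $ k = (\<Sum>j<n. aug A' b' (i, j) * x' $ j)"
      using k I x'(1) by (simp add: scalar_prod_def atLeast0LessThan)
    then show ?thesis
      using k x' A by (simp add: hom_coord_def aug_def)
  qed
  have sgn_cancel: "sgn r' = sgn r"
    if "sgn (r * det ?B) = sgn (r' * det ?B')" for r r' :: real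
    using that sgn_B det_B det_B' by (simp add: sgn_mult) (metis mult_cancel_right sgn_0_0)
  have "0 \<le> x' $ j" if j: "j < n" for j
  proof -
    have "set ([0..<n][j := n]) \<subseteq> {..n}"
      using set_update_subset_insert[of "[0..<n]" j n] by force
    then have "sgn (- x $ j * det ?B) = sgn (- x' $ j * det ?B')"
      using cramer_coordinate[OF A(1) b(1) x_carrier I x_tight j]
        cramer_coordinate[OF A(2) b(2) x'(1) I x'_tight j]
        sgn_det[of "indices I" "[0..<n][j := n]"] I finI j
      by (simp add: distinct_list_update)
    then have "sgn (- x' $ j) = sgn (- x $ j)"
      by (rule sgn_cancel)
    then show ?thesis
      using x_poly j by (auto simp: sgn_real_def split: if_splits)
  qed
  moreover have "0 \<le> (\<Sum>j<Suc n. aug A' b' (k, j) * hom_coord x' j)" (is "0 \<le> ?s' k")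
    if k: "k < m" for k
  \<comment> \<open>Rows of \<open>I\<close> have slack zero and are split off, because
    \<open>indices I @ [k]\<close> would repeat an index.\<close>
  proof (cases "k \<in> I")
    case True
    then show ?thesis using x'_tight by simp
  next
    case False
    let ?s = "\<Sum>j<Suc n. aug A b (k, j) * hom_coord x j"
    have "det (selmat (aug A b) (indices I @ [k]) [0..<Suc n]) = ?s * det ?B"
      by (rule cramer_slack[OF A(1) b(1) x_carrier I x_tight])
    moreover have "det (selmat (aug A' b') (indices I @ [k]) [0..<Suc n]) = ?s' k * det ?B'"
      by (rule cramer_slack[OF A(2) b(2) x'(1) I x'_tight])
    moreover have "sgn (det (selmat (aug A b) (indices I @ [k]) [0..<Suc n])) =
        sgn (det (selmat (aug A' b') (indices I @ [k]) [0..<Suc n]))"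
      using I finI k False by (intro sgn_det) auto
    ultimately have "sgn (?s * det ?B) = sgn (?s' k * det ?B')"
      by simp
    then have "sgn (?s' k) = sgn ?s"
      by (rule sgn_cancel)
    moreover have "0 \<le> ?s"
      using x_poly k by blast
    ultimately show ?thesis
      by (auto simp: sgn_real_def split: if_splits)
  qed
  ultimately have "x' \<in> polyhedron A' b'"
    unfolding mem_polyhedron_iff[OF A(2) b(2)] using x'(1) by blast
  moreover have "row A' i \<bullet> x' + b' $ i = 0" if "i \<in> I" for i
    using row_add_index[OF A(2) b(2) x'(1), of i] x'_tight[OF that] I that by auto
  ultimately show ?thesis
    using I A det_B' submatrix_eq_selmat_aug[OF A(2) I] by (auto simp: lp_basis_def)
qed

section \<open>Points of tropical polyhedra and points of their lifts\<close>

text \<open>Cancelling the sum means subtracting \<open>s / z k\<close>, whose sign is opposite to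
  that of \<open>r k\<close>, so the entry only grows in modulus. As the k-th term dominates, the
  sum is at most N times that term, whence the factor \<open>N + 1\<close>.\<close>

lemma adjust_entry:
  fixes r z :: "nat \<Rightarrow> real"
  assumes k: "k < N" and z: "0 < z k"
    and dom: "\<And>j. j < N \<Longrightarrow> \<bar>r j * z j\<bar> \<le> \<bar>r k * z k\<bar>"
    and sgn: "sgn (r k) = - sgn (\<Sum>j<N. r j * z j)" "r k \<noteq> 0"
  shows "\<exists>t. sgn t = sgn (r k) \<and> \<bar>r k\<bar> \<le> \<bar>t\<bar> \<and> \<bar>t\<bar> \<le> (real N + 1) * \<bar>r k\<bar> \<and>
    (\<Sum>j<N. (r(k := t)) j * z j) = 0"
proof -
  define s where "s = (\<Sum>j<N. r j * z j)"
  define t where "t = r k - s / z k"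
  have "\<bar>s\<bar> \<le> (\<Sum>j<N. \<bar>r k * z k\<bar>)"
    unfolding s_def using dom by (intro order_trans[OF sum_abs] sum_mono) auto
  then have "\<bar>s\<bar> \<le> real N * \<bar>r k\<bar> * z k"
    using z by (simp add: abs_mult)
  then have s_le: "\<bar>s / z k\<bar> \<le> real N * \<bar>r k\<bar>"
    using z by (simp add: field_simps)
  have "sgn (r k) = - sgn (s / z k)"
    using sgn(1) z by (simp add: s_def sgn_divide)
  moreover have "sgn (a - q) = sgn a \<and> \<bar>a - q\<bar> = \<bar>a\<bar> + \<bar>q\<bar>" if "sgn a = - sgn q" for a q :: real
    using that by (auto simp: sgn_real_def split: if_splits)
  ultimately have "sgn t = sgn (r k) \<and> \<bar>t\<bar> = \<bar>r k\<bar> + \<bar>s / z k\<bar>"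
    unfolding t_def by blast
  moreover have "(\<Sum>j<N. (r(k := t)) j * z j) = 0"
  proof -
    have "(\<Sum>j<N. (r(k := t)) j * z j) = t * z k + (\<Sum>j\<in>{..<N} - {k}. r j * z j)"
      using k by (subst sum.remove[of _ k]) auto
    also have "(\<Sum>j\<in>{..<N} - {k}. r j * z j) = s - r k * z k"
      using k unfolding s_def by (subst sum.remove[of "{..<N}" k]) auto
    finally show ?thesis
      using z by (simp add: t_def field_simps)
  qed
  ultimately show ?thesis
    using s_le by (intro exI[of _ t]) (auto simp: field_simps)
qed

lemma modulus_le_iff: "modulus x * y \<le> w \<longleftrightarrow> pos_part x * y \<le> w \<and> neg_part x * y \<le> w"
  for w :: "'g::linordered_ab_group_add trop"
  by (cases x) auto

context real_hom
begin

definition canonical_lift :: "'g signed_trop \<Rightarrow> real" where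
  "canonical_lift x = of_int (trop_sign x) * texp h (modulus x)"

lemma lifts_canonical_lift: "1 \<le> U \<Longrightarrow> lifts h U x (canonical_lift x)"
  by (cases x) (auto simp: lifts_def canonical_lift_def)

lemma canonical_lift_zero [simp]: "canonical_lift 0 = 0"
  by (simp add: canonical_lift_def zero_signed_trop_def)

text \<open>
  If the maximum of the terms is attained with both signs, enlarging one maximal entry makes the
  real sum vanish; if it is attained with the positive sign, enlarging a positive maximal entry
  makes the real sum non-negative.
\<close>

lemma lift_row:
  fixes F :: "nat \<Rightarrow> 'g signed_trop" and \<xi> :: "nat \<Rightarrow> 'g trop" and N :: nat
  defines "neg_sum \<equiv> \<Sum>j<N. neg_part (F j) * \<xi> j" and "pos_sum \<equiv> \<Sum>j<N. pos_part (F j) * \<xi> j"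
  assumes \<xi>: "\<And>j. j < N \<Longrightarrow> \<xi> j \<noteq> 0"
    and mono: "\<And>j k. j < N \<Longrightarrow> k < N \<Longrightarrow> modulus (F j) * \<xi> j \<le> modulus (F k) * \<xi> k \<Longrightarrow>
      texp h (modulus (F j) * \<xi> j) \<le> texp h (modulus (F k) * \<xi> k)"
    and le: "neg_sum \<le> pos_sum"
  shows "\<exists>r. (\<forall>j<N. lifts h (real N + 1) (F j) (r j)) \<and> 0 \<le> (\<Sum>j<N. r j * texp h (\<xi> j)) \<and>
    (neg_sum = pos_sum \<longrightarrow> (\<Sum>j<N. r j * texp h (\<xi> j)) = 0)"
proof -
  define r where "r j = canonical_lift (F j)" for j
  define s where "s = (\<Sum>j<N. r j * texp h (\<xi> j))"
  have r_lifts: "lifts h (real N + 1) (F j) (r j)" for j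
    unfolding r_def by (rule lifts_canonical_lift) simp
  have adjust: ?thesis
    if k: "k < N" "modulus (F k) * \<xi> k = pos_sum" "sgn (r k) = - sgn s" "s \<noteq> 0" for k
  proof -
    have abs_r: "\<bar>r j * texp h (\<xi> j)\<bar> = texp h (modulus (F j) * \<xi> j)" for j
      by (cases "F j") (simp_all add: r_def canonical_lift_def abs_mult texp_mult)
    have "modulus (F j) * \<xi> j \<le> pos_sum" if "j < N" for j
      using that le trop_le_sum[of "{..<N}" j "\<lambda>j. pos_part (F j) * \<xi> j"]
        trop_le_sum[of "{..<N}" j "\<lambda>j. neg_part (F j) * \<xi> j"]
      unfolding modulus_le_iff pos_sum_def neg_sum_def by auto
    then have dom: "\<bar>r j * texp h (\<xi> j)\<bar> \<le> \<bar>r k * texp h (\<xi> k)\<bar>" if "j < N" for j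
      using that mono[OF that k(1)] k(2) by (simp add: abs_r)
    have "r k \<noteq> 0"
      using k(3,4) by (auto simp: sgn_zero_iff)
    then obtain t where t: "sgn t = sgn (r k)" "\<bar>r k\<bar> \<le> \<bar>t\<bar>" "\<bar>t\<bar> \<le> (real N + 1) * \<bar>r k\<bar>"
        "(\<Sum>j<N. (r(k := t)) j * texp h (\<xi> j)) = 0"
      using adjust_entry[OF k(1), of "\<lambda>j. texp h (\<xi> j)" r] dom k(3) \<xi>[OF k(1)]
      unfolding s_def by auto
    have "\<bar>r k\<bar> = texp h (modulus (F k))"
      by (cases "F k") (simp_all add: r_def canonical_lift_def)
    then have "lifts h (real N + 1) (F k) t"
      using t r_lifts[of k] by (simp add: lifts_def)
    then show ?thesis
      using t(4) r_lifts by (intro exI[of _ "r(k := t)"]) auto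
  qed
  \<comment> \<open>Used with \<open>\<sigma>\<close> equal to 1 and to -1: a non-zero sum has a
    term of its own sign.\<close>
  have sign_term: "\<exists>j<N. 0 < \<sigma> * r j" if "0 < \<sigma> * s" for \<sigma> :: real
  proof (rule ccontr)
    assume "\<not> (\<exists>j<N. 0 < \<sigma> * r j)"
    then have "\<sigma> * r j * texp h (\<xi> j) \<le> 0" if "j < N" for j
      using that by (metis mult_nonpos_nonneg not_less texp_nonneg)
    then have "(\<Sum>j<N. \<sigma> * r j * texp h (\<xi> j)) \<le> 0"
      by (intro sum_nonpos) auto
    then show False
      using that by (simp add: s_def sum_distrib_left mult.assoc)
  qed
  show ?thesis
  proof (cases s "0 :: real" rule: linorder_cases)
    case equal
    then show ?thesis
      using r_lifts by (intro exI[of _ r]) (auto simp: s_def)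
  next
    \<comment> \<open>A negative term makes \<open>neg_sum\<close>, and with it
      \<open>pos_sum\<close>, non-zero. Then \<open>pos_sum\<close> is attained at a positive entry,
      which has the sign required for the correction.\<close>
    case less
    then obtain j where "j < N" "r j < 0"
      using sign_term[of "- 1"] by auto
    then have "neg_part (F j) * \<xi> j \<noteq> 0"
      using \<xi>[of j] by (cases "F j"; cases "\<xi> j") (auto simp: r_def canonical_lift_def zero_trop_def)
    then have "pos_sum \<noteq> 0"
      using \<open>j < N\<close> le trop_le_sum[of "{..<N}" j "\<lambda>j. neg_part (F j) * \<xi> j"]
      by (auto simp: neg_sum_def)
    then obtain k where k: "k < N" "pos_part (F k) * \<xi> k = pos_sum"
      using trop_sum_attained[of "{..<N}" "\<lambda>j. pos_part (F j) * \<xi> j"]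
      unfolding pos_sum_def by blast
    then have "pos_part (F k) \<noteq> 0"
      using \<open>pos_sum \<noteq> 0\<close> by auto
    then show ?thesis
      using less k by (intro adjust[of k])
        (cases "F k"; simp add: r_def canonical_lift_def zero_trop_def)+
  next
    case greater
    show ?thesis
    proof (cases "neg_sum = pos_sum")
      case False
      then show ?thesis
        using greater r_lifts by (intro exI[of _ r]) (auto simp: s_def)
    next
      case True
      \<comment> \<open>In a tie, a positive term makes both sides non-zero, and enlarging a maximal
        negative entry lowers the real sum to zero.\<close>
      obtain j where "j < N" "0 < r j"
        using greater sign_term[of 1] by auto
      then have "pos_part (F j) * \<xi> j \<noteq> 0"
        using \<xi>[of j] by (cases "F j"; cases "\<xi> j") (auto simp: r_def canonical_lift_def zero_trop_def)
      then have "neg_sum \<noteq> 0"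
        using \<open>j < N\<close> True trop_le_sum[of "{..<N}" j "\<lambda>j. pos_part (F j) * \<xi> j"]
        by (auto simp: pos_sum_def)
      then obtain k where k: "k < N" "neg_part (F k) * \<xi> k = neg_sum"
        using trop_sum_attained[of "{..<N}" "\<lambda>j. neg_part (F j) * \<xi> j"]
        unfolding neg_sum_def by blast
      then have "neg_part (F k) \<noteq> 0"
        using \<open>neg_sum \<noteq> 0\<close> by auto
      then show ?thesis
        using greater k True by (intro adjust[of k])
          (cases "F k"; simp add: r_def canonical_lift_def zero_trop_def)+
    qed
  qed
qed

text \<open>A constraint involves only its own row, so \<open>lift_row\<close> can be used row by
  row with one point, the coordinatewise exponential of \<open>x\<close>. A row of
  \<open>aug A b\<close> has n + 1 entries, hence the constant n + 2.\<close>

lemma realize_trop_point: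
  fixes A :: "'g signed_trop mat" and b :: "'g signed_trop vec" and x :: "'g trop vec"
  assumes A: "A \<in> carrier_mat m n" and b: "b \<in> carrier_vec m"
    and x: "x \<in> trop_polyhedron A b" "\<And>j. j < n \<Longrightarrow> x $ j \<noteq> 0"
    and mono: "\<And>i j k. i < m \<Longrightarrow> j < Suc n \<Longrightarrow> k < Suc n \<Longrightarrow>
      modulus (aug A b (i, j)) * hom_coord x j \<le> modulus (aug A b (i, k)) * hom_coord x k \<Longrightarrow>
      texp h (modulus (aug A b (i, j)) * hom_coord x j)
        \<le> texp h (modulus (aug A b (i, k)) * hom_coord x k)"
  shows "\<exists>A' b'. A' \<in> carrier_mat m n \<and> b' \<in> carrier_vec m \<and>
    (\<forall>i<m. \<forall>j<Suc n. lifts h (real n + 2) (aug A b (i, j)) (aug A' b' (i, j))) \<and>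
    (\<exists>x'\<in>polyhedron A' b'. \<forall>i<m. trop_lhs A b x $ i = trop_rhs A b x $ i \<longrightarrow>
      row A' i \<bullet> x' + b' $ i = 0)"
proof -
  note x_iff = mem_trop_polyhedron_iff[OF A b]
  have x_carrier: "x \<in> carrier_vec n"
    using x(1) x_iff(1) by blast
  define P where "P i r \<longleftrightarrow>
      (\<forall>j<Suc n. lifts h (real (Suc n) + 1) (aug A b (i, j)) (r j)) \<and>
      0 \<le> (\<Sum>j<Suc n. r j * texp h (hom_coord x j)) \<and>
      ((\<Sum>j<Suc n. neg_part (aug A b (i, j)) * hom_coord x j) =
          (\<Sum>j<Suc n. pos_part (aug A b (i, j)) * hom_coord x j) \<longrightarrow>
        (\<Sum>j<Suc n. r j * texp h (hom_coord x j)) = 0)" for i r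
  have "\<exists>r. P i r" if "i < m" for i
    unfolding P_def
  proof (rule lift_row)
    show "hom_coord x j \<noteq> 0" for j
      using x(2) x_carrier by (auto simp: hom_coord_def)
    show "(\<Sum>j<Suc n. neg_part (aug A b (i, j)) * hom_coord x j)
        \<le> (\<Sum>j<Suc n. pos_part (aug A b (i, j)) * hom_coord x j)"
      using x(1) that unfolding x_iff(1) by blast
  qed (rule mono[OF that])
  then obtain r where "\<And>i. i < m \<Longrightarrow> P i (r i)"
    by metis
  note r = this[unfolded P_def]
  define A' where "A' = mat m n (\<lambda>(i, j). r i j)"
  define b' where "b' = vec m (\<lambda>i. r i n)"
  define x' where "x' = map_vec (texp h) x"
  have A': "A' \<in> carrier_mat m n" and b': "b' \<in> carrier_vec m" and x': "x' \<in> carrier_vec n"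
    using x_carrier by (simp_all add: A'_def b'_def x'_def)
  have aug': "aug A' b' (i, j) = r i j" if "i < m" "j < Suc n" for i j
    using that by (auto simp: aug_def A'_def b'_def less_Suc_eq)
  have hom': "hom_coord x' j = texp h (hom_coord x j)" for j
    using x_carrier by (simp add: hom_coord_def x'_def)
  have sum': "(\<Sum>j<Suc n. aug A' b' (i, j) * hom_coord x' j) =
      (\<Sum>j<Suc n. r i j * texp h (hom_coord x j))" if "i < m" for i
    using that by (intro sum.cong) (auto simp: aug' hom')
  have "x' \<in> polyhedron A' b'"
    unfolding mem_polyhedron_iff[OF A' b'] using x' x_carrier r sum' by (auto simp: x'_def)
  moreover have "row A' i \<bullet> x' + b' $ i = 0"
    if "i < m" "trop_lhs A b x $ i = trop_rhs A b x $ i" for i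
    using that r[OF that(1)] x_iff(2,3)[OF x_carrier that(1)] sum'[OF that(1)]
    unfolding row_add_index[OF A' b' x' that(1)] by simp
  moreover have "lifts h (real n + 2) (aug A b (i, j)) (aug A' b' (i, j))" if "i < m" "j < Suc n" for i j
    using r[OF that(1)] that aug'[OF that] by (simp add: add.commute)
  ultimately show ?thesis
    using A' b' by blast
qed

text \<open>In a row satisfied by \<open>x'\<close>, every negative term is at most n + 1 times some
  positive one; with the factor \<open>U\<close> and after logarithms this is a difference
  constraint with error \<open>L\<close>. Solved over the group, these constraints bound every
  negative tropical term by a positive one. The bound \<open>g\<close> is one more constraint,
  against the homogenizing coordinate.\<close>

lemma tropicalize_real_point:
  fixes A :: "'g signed_trop mat" and b :: "'g signed_trop vec" and x' :: "real vec"
  defines "D E \<equiv> {a - b | a b. a \<in> E \<and> b \<in> (E :: 'g set)}"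
  assumes A: "A \<in> carrier_mat m n" "A' \<in> carrier_mat m n"
    and b: "b \<in> carrier_vec m" "b' \<in> carrier_vec m"
    and lift: "\<And>i j. i < m \<Longrightarrow> j < Suc n \<Longrightarrow> lifts h U (aug A b (i, j)) (aug A' b' (i, j))"
    and x': "x' \<in> polyhedron A' b'"
    and E: "finite E" "0 \<in> E" "g \<in> E"
      "\<And>i j a. i < m \<Longrightarrow> j < Suc n \<Longrightarrow> modulus (aug A b (i, j)) = TVal a \<Longrightarrow> a \<in> E"
    and L: "0 \<le> L" "real (Suc n) * U \<le> exp L"
    and large: "\<And>d. d \<in> sumset (D E) (2 ^ Suc n) \<Longrightarrow> 0 < d \<Longrightarrow> 2 ^ Suc n * L < h d"
  shows "\<exists>x\<in>trop_polyhedron A b. (\<forall>j<n. x $ j = 0 \<longleftrightarrow> x' $ j = 0) \<and>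
    (\<forall>j<n. exp (h g) \<le> x' $ j \<longrightarrow> TVal g \<le> x $ j)"
proof -
  note x'_poly = x'[unfolded mem_polyhedron_iff[OF A(2) b(2)]]
  define z where "z = hom_coord x'"
  define u where "u j = ln (z j)" for j
  \<comment> \<open>Only coordinates in the support have a meaningful logarithm; the others become
    tropical zeros. The index n is in the support because \<open>z n = 1\<close>.\<close>
  define V where "V = {j. j < Suc n \<and> 0 < z j}"
  have zn: "z n = 1" and zj: "\<And>j. j < n \<Longrightarrow> z j = x' $ j"
    using x'_poly by (auto simp: z_def hom_coord_def)
  have z_nonneg: "0 \<le> z j" if "j < Suc n" for j
    using that zn zj x'_poly by (cases "j = n") auto
  have "n \<in> V"
    by (simp add: V_def zn)
  have finD: "finite (D E)"
    unfolding D_def using E(1) by (rule_tac finite_subset[of _ "(\<lambda>(a, b). a - b) ` (E \<times> E)"]) auto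
  have D0: "0 \<in> D E"
    using E(2) by (force simp: D_def)
  have "card V \<le> card {..<Suc n}"
    by (intro card_mono) (auto simp: V_def)
  then have pow_le: "(2::nat) ^ card V \<le> 2 ^ Suc n"
    by (intro power_increasing) auto
  have "\<exists>y :: nat \<Rightarrow> 'g. \<forall>i\<in>V. \<forall>j\<in>V. \<forall>d\<in>D E. u i \<le> u j + h d + L \<longrightarrow> y i \<le> y j + d"
  proof (rule difference_constraints[OF _ finD D0 L(1) h_add])
    show "finite V" by (simp add: V_def)
    fix d assume d: "d \<in> sumset (D E) (2 ^ card V)" "d < 0"
    have "- d \<in> sumset (D E) (2 ^ card V)"
      using d(1) by (rule uminus_in_sumset[rotated]) (force simp: D_def)
    then have "- d \<in> sumset (D E) (2 ^ Suc n)"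
      using sumset_mono[OF D0 pow_le] by blast
    then have "2 ^ Suc n * L < h (- d)"
      using d(2) by (intro large) auto
    moreover have "(2 ^ card V :: real) * L \<le> 2 ^ Suc n * L"
      using pow_le L(1) by (intro mult_right_mono) (auto simp flip: of_nat_le_iff[where 'a = real])
    ultimately show "h d < - (2 ^ card V * L)"
      by (simp add: h_minus)
  qed
  then obtain y :: "nat \<Rightarrow> 'g" where y: "\<And>i j d. i \<in> V \<Longrightarrow> j \<in> V \<Longrightarrow> d \<in> D E \<Longrightarrow>
      u i \<le> u j + h d + L \<Longrightarrow> y i \<le> y j + d"
    by blast
  \<comment> \<open>Subtracting \<open>y n\<close> makes the homogenizing coordinate the tropical
    unit and leaves differences of coordinates unchanged.\<close>
  define x where "x = vec n (\<lambda>j. if j \<in> V then TVal (y j - y n) else 0)"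
  have x: "x \<in> carrier_vec n"
    by (simp add: x_def)
  have \<xi>: "hom_coord x j = (if j \<in> V then TVal (y j - y n) else 0)" if "j < Suc n" for j
    using that \<open>n \<in> V\<close> by (auto simp: hom_coord_def x_def less_Suc_eq one_trop_def)
  have "x \<in> trop_polyhedron A b"
    unfolding mem_trop_polyhedron_iff(1)[OF A(1) b(1)]
  proof (intro conjI allI impI x)
    fix i assume i: "i < m"
    let ?pos = "\<Sum>j<Suc n. pos_part (aug A b (i, j)) * hom_coord x j"
    have "neg_part (aug A b (i, j)) * hom_coord x j \<le> ?pos" if j: "j < Suc n" for j
    proof (cases "j \<in> V \<and> (\<exists>a. aug A b (i, j) = SNeg a)")
      case False
      then have "neg_part (aug A b (i, j)) * hom_coord x j = 0"
        using \<xi>[OF j] by (cases "aug A b (i, j)") (auto simp: zero_trop_def)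
      then show ?thesis by (metis trop_zero_le)
    next
      case True
      then obtain a where a: "aug A b (i, j) = SNeg a" and "j \<in> V" by blast
      define e where "e = exp (h a) * z j"
      have "0 < e"
        using \<open>j \<in> V\<close> by (simp add: e_def V_def)
      have "aug A' b' (i, j) \<le> - exp (h a)"
        using lift[OF i j] a by (auto simp: lifts_def sgn_real_def split: if_splits)
      then have le_e: "aug A' b' (i, j) * z j \<le> - e"
        using z_nonneg[OF j] mult_right_mono by (fastforce simp: e_def)
      \<comment> \<open>The terms add up to at least 0 and the j-th is at most \<open>- e\<close>.
        If the n others were all at most \<open>e / real (Suc n)\<close>, they could not compensate
        it.\<close>
      have "\<exists>k<Suc n. e / real (Suc n) < aug A' b' (i, k) * z k"
      proof (rule ccontr)
        assume "\<not> ?thesis"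
        then have "aug A' b' (i, k) * z k \<le> e / real (Suc n)" if "k < Suc n" for k
          using that by (metis not_less)
        then have "(\<Sum>k\<in>{..<Suc n} - {j}. aug A' b' (i, k) * z k)
            \<le> (\<Sum>k\<in>{..<Suc n} - {j}. e / real (Suc n))"
          by (intro sum_mono) blast
        also have "\<dots> = real n * (e / real (Suc n))"
          using j by simp
        also have "\<dots> < e"
          using \<open>0 < e\<close> by (simp add: field_simps)
        finally have "(\<Sum>k<Suc n. aug A' b' (i, k) * z k) < 0"
          using le_e j by (subst sum.remove[of _ j]) auto
        moreover have "0 \<le> (\<Sum>k<Suc n. aug A' b' (i, k) * z k)"
          using x'_poly i unfolding z_def by blast
        ultimately show False by simp
      qed
      then obtain k where k: "k < Suc n" "e / real (Suc n) < aug A' b' (i, k) * z k"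
        by blast
      have "0 < aug A' b' (i, k) * z k"
        using k(2) \<open>0 < e\<close> by (smt (verit) divide_pos_pos of_nat_0_less_iff zero_less_Suc)
      then have pos_k: "0 < aug A' b' (i, k)" "0 < z k"
        using z_nonneg[OF k(1)] by (auto simp: zero_less_mult_iff)
      then have "k \<in> V"
        using k(1) by (simp add: V_def)
      obtain a' where a': "aug A b (i, k) = SPos a'" "aug A' b' (i, k) \<le> U * exp (h a')"
        using lift[OF i k(1)] pos_k(1) by (cases "aug A b (i, k)") (auto simp: lifts_def)
      have "e < real (Suc n) * (aug A' b' (i, k) * z k)"
        using k(2) by (simp add: field_simps)
      also have "\<dots> \<le> real (Suc n) * (U * exp (h a') * z k)"
        using a'(2) pos_k(2) by (intro mult_left_mono mult_right_mono) auto
      also have "\<dots> = real (Suc n) * U * (exp (h a') * z k)"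
        by (simp add: mult_ac)
      also have "\<dots> \<le> exp L * (exp (h a') * z k)"
        using L(2) pos_k(2) by (intro mult_right_mono) auto
      finally have "exp (h a) * z j \<le> exp L * (exp (h a') * z k)"
        by (simp add: e_def)
      then have "ln (exp (h a) * z j) \<le> ln (exp L * (exp (h a') * z k))"
        using \<open>0 < e\<close> by (intro ln_mono) (auto simp: e_def)
      then have "h a + u j \<le> L + (h a' + u k)"
        using pos_k \<open>j \<in> V\<close> by (simp add: ln_mult u_def V_def)
      then have "u j \<le> u k + h (a' - a) + L"
        by (simp add: h_diff)
      moreover have "a' - a \<in> D E"
        using E(4)[OF i j, of a] E(4)[OF i k(1), of a'] a a' by (auto simp: D_def)
      ultimately have "y j \<le> y k + (a' - a)"
        using \<open>j \<in> V\<close> \<open>k \<in> V\<close> by (intro y)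
      then have "a + (y j - y n) \<le> a' + (y k - y n)"
        by (simp add: algebra_simps)
      then have "neg_part (aug A b (i, j)) * hom_coord x j
          \<le> pos_part (aug A b (i, k)) * hom_coord x k"
        using \<open>j \<in> V\<close> \<open>k \<in> V\<close> by (simp add: a a' \<xi>[OF j] \<xi>[OF k(1)])
      also have "\<dots> \<le> ?pos"
        using k(1) by (intro trop_le_sum) auto
      finally show ?thesis .
    qed
    then show "(\<Sum>j<Suc n. neg_part (aug A b (i, j)) * hom_coord x j) \<le> ?pos"
      by (subst trop_sum_le_iff) auto
  qed
  moreover have "x $ j = 0 \<longleftrightarrow> x' $ j = 0" if "j < n" for j
    using that z_nonneg[of j] zj by (auto simp: x_def V_def zero_trop_def)
  moreover have "TVal g \<le> x $ j" if j: "j < n" "exp (h g) \<le> x' $ j" for j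
  proof -
    have "0 < z j"
      using j zj by (smt (verit) exp_gt_zero)
    then have "j \<in> V"
      using j by (simp add: V_def)
    have "h g \<le> u j"
      using j(2) zj[OF j(1)] \<open>0 < z j\<close> by (simp add: u_def ln_ge_iff)
    \<comment> \<open>Since \<open>u n = 0\<close>, the real bound is a constraint between n and j
      with weight \<open>0 - g\<close>; hence both 0 and g have to be in \<open>E\<close>.\<close>
    moreover have "0 - g \<in> D E"
      using E(2,3) unfolding D_def by blast
    ultimately have "y n \<le> y j + (0 - g)"
      using \<open>n \<in> V\<close> \<open>j \<in> V\<close> L(1) by (intro y) (auto simp: u_def zn h_minus)
    then have "g \<le> y j - y n"
      by (simp add: algebra_simps)
    then show ?thesis
      using j \<open>j \<in> V\<close> by (simp add: x_def)
  qed
  ultimately show ?thesis by blast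
qed

end

section \<open>The lifted program\<close>

lemma tper_sign_nonzero:
  assumes "trop_nonsingular W"
  shows "tper_sign W \<noteq> 0"
proof -
  have nz: "tper W \<noteq> 0"
    and ex1: "\<exists>!p. p permutes {0..<dim_row W} \<and> tper_term W p = tper W"
    using assms by (auto simp: trop_nonsingular_def)
  define s where "s = (THE p. p permutes {0..<dim_row W} \<and> tper_term W p = tper W)"
  have s: "tper_term W s = tper W"
    using theI'[OF ex1] by (simp add: s_def)
  have "trop_sign (W $$ (i, s i)) \<noteq> 0" if i: "i < dim_row W" for i
  proof
    assume "trop_sign (W $$ (i, s i)) = 0"
    then have "modulus (W $$ (i, s i)) = 0"
      by (cases "W $$ (i, s i)") (auto simp: zero_trop_def)
    then have "tper_term W s = 0"
      unfolding tper_term_def using i by (intro prod_zero) auto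
    then show False
      using s nz by simp
  qed
  then show ?thesis
    unfolding tper_sign_def s_def[symmetric] Let_def using nz by (simp add: sign_def)
qed

lemma lp_matrix_carrier:
  "A \<in> carrier_mat m n \<Longrightarrow> lp_matrix A b c \<in> carrier_mat (Suc m) (Suc n)"
  by (simp add: lp_matrix_def)

lemma aug_eq_lp_matrix:
  "A \<in> carrier_mat m n \<Longrightarrow> i < m \<Longrightarrow> j < Suc n \<Longrightarrow> aug A b (i, j) = lp_matrix A b c $$ (i, j)"
  by (simp add: aug_def lp_matrix_def)

lemma submatrix_eq_selmat_lp_matrix:
  assumes "A \<in> carrier_mat m n" "I \<subseteq> {..<m}" "card I = n"
  shows "submatrix A I UNIV = selmat (($$) (lp_matrix A b c)) (indices I) [0..<n]"
proof -
  have "indices I ! k < m \<and> indices I ! k < Suc m" if "k < n" for k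
    using that assms finite_subset[OF assms(2)] nth_mem[of k "indices I"] by auto
  then show ?thesis
    using assms by (auto simp: submatrix_UNIV_eq_selmat lp_matrix_def intro!: eq_matI)
qed

text \<open>The objective row m takes the position of row i, as in \<open>replace_row\<close>. In
  increasing order it would come last, which may change the sign of the minor.\<close>

definition exchange :: "nat \<Rightarrow> nat \<Rightarrow> nat list \<Rightarrow> nat list" where
  "exchange i m xs = map (\<lambda>k. if k = i then m else k) xs"

lemma submatrix_replace_row_eq_selmat:
  assumes "A \<in> carrier_mat m n" "I \<subseteq> {..<m}" "card I = n"
  shows "submatrix (replace_row A i c) I UNIV =
    selmat (($$) (lp_matrix A b c)) (exchange i m (indices I)) [0..<n]"
proof -
  have "indices I ! k < m \<and> indices I ! k < Suc m" if "k < n" for k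
    using that assms finite_subset[OF assms(2)] nth_mem[of k "indices I"] by auto
  then show ?thesis
    using assms
    by (auto simp: submatrix_UNIV_eq_selmat replace_row_def lp_matrix_def exchange_def intro!: eq_matI)
qed

lemma exchange_indices:
  assumes "I \<subseteq> {..<m}"
  shows "distinct (exchange i m (indices I))" "set (exchange i m (indices I)) \<subseteq> {..<Suc m}"
    "length (exchange i m (indices I)) = card I"
proof -
  have "set (indices I) = I"
    using assms finite_subset[OF assms] by simp
  then show "distinct (exchange i m (indices I))" "set (exchange i m (indices I)) \<subseteq> {..<Suc m}"
    using assms by (auto simp: exchange_def distinct_map inj_on_def)
  show "length (exchange i m (indices I)) = card I"
    by (simp add: exchange_def)
qed

context divisible_group
begin

lemma real_lift_of_program:
  fixes A :: "'g signed_trop mat" and b :: "'g signed_trop vec" and c :: "'g trop vec"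
  assumes nondeg: "nondegenerate_trop_lp n m A b c"
  shows "\<exists>A' b' c'. nondegenerate_lp n m A' b' c' \<and>
    minor_oracle det_sign (lp_matrix A' b' c') = minor_oracle tper_sign (trop_lp_matrix A b c) \<and>
    (\<forall>I. trop_basis A b I \<longrightarrow> lp_basis A' b' I \<and>
      (\<forall>i. neg_reduced_cost A' c' I i \<longleftrightarrow> neg_trop_reduced_cost A c I i))"
proof -
  have A: "A \<in> carrier_mat m n" and b: "b \<in> carrier_vec m" and c: "c \<in> carrier_vec n"
    and pos: "\<And>x j. x \<in> trop_polyhedron A b \<Longrightarrow> j < n \<Longrightarrow> x $ j \<noteq> 0"
    and generic: "trop_generic (trop_lp_matrix A b c)"
    using nondeg by (auto simp: nondegenerate_trop_lp_def)
  obtain g where g: "\<And>x j. x \<in> trop_polyhedron A b \<Longrightarrow> j < n \<Longrightarrow> x $ j < TVal g"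
    using nondeg by (auto simp: nondegenerate_trop_lp_def)
  define M where "M = trop_lp_matrix A b c"
  have M: "M \<in> carrier_mat (Suc m) (Suc n)"
    unfolding M_def using A by (rule lp_matrix_carrier)
  have aug_M: "aug A b (i, j) = M $$ (i, j)" if "i < m" "j < Suc n" for i j
    unfolding M_def by (rule aug_eq_lp_matrix[OF A that])
  \<comment> \<open>The points of all tropical bases are chosen before \<open>h\<close>, because
    their coordinates enter the finite set on which \<open>h\<close> depends.\<close>
  have "\<exists>x. trop_basis A b I \<longrightarrow> x \<in> trop_polyhedron A b \<and>
      (\<forall>i\<in>I. trop_lhs A b x $ i = trop_rhs A b x $ i)" for I
    unfolding trop_basis_def by blast
  then obtain X where X: "\<And>I. trop_basis A b I \<Longrightarrow>
      X I \<in> trop_polyhedron A b \<and> (\<forall>i\<in>I. trop_lhs A b (X I) $ i = trop_rhs A b (X I) $ i)"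
    by metis

  \<comment> \<open>For a set that is not a basis \<open>X I\<close> is arbitrary; ranging over
    \<open>Pow {..<m}\<close> makes finiteness evident. A tropical zero contributes 0.\<close>
  define E where "E = {0, g} \<union>
    (\<lambda>(i, j). tval (modulus (M $$ (i, j)))) ` ({..<Suc m} \<times> {..<Suc n}) \<union>
    (\<lambda>(I, j). tval (X I $ j)) ` (Pow {..<m} \<times> {..<n})"
  have E: "finite E" "0 \<in> E" "g \<in> E"
    by (simp_all add: E_def)
  have E_M: "a \<in> E" if "i < Suc m" "j < Suc n" "modulus (M $$ (i, j)) = TVal a" for i j a
  proof -
    have "a = (\<lambda>(i, j). tval (modulus (M $$ (i, j)))) (i, j)"
      using that by simp
    then show ?thesis
      unfolding E_def using that(1,2) by blast
  qed
  have E_X: "a \<in> E" if "I \<subseteq> {..<m}" "j < n" "X I $ j = TVal a" for I j a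
  proof -
    have "a = (\<lambda>(I, j). tval (X I $ j)) (I, j)"
      using that by simp
    then show ?thesis
      unfolding E_def using that(1,2) by blast
  qed
  define D where "D = {a - b | a b. a \<in> E \<and> b \<in> E}"
  have D: "finite D" "0 \<in> D"
  proof -
    have "D = (\<lambda>(a, b). a - b) ` (E \<times> E)"
      by (auto simp: D_def)
    then show "finite D" using E(1) by simp
    show "0 \<in> D" using E(2) by (force simp: D_def)
  qed
  have D_diff: "a - b \<in> D" if "a \<in> E" "b \<in> E" for a b
    using that by (auto simp: D_def)

  \<comment> \<open>\<open>U\<close> is the correction made by \<open>realize_trop_point\<close>.
    \<open>L\<close> is the logarithm of the loss in \<open>tropicalize_real_point\<close>: n + 1
    terms in a row and a factor \<open>U\<close> in an entry.\<close>
  define U where "U = real n + 2"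
  define L where "L = ln (real (Suc n) * U)"
  have U: "1 \<le> U"
    by (simp add: U_def)
  then have "1 * 1 \<le> real (Suc n) * U"
    by (intro mult_mono) auto
  then have L: "0 \<le> L" "real (Suc n) * U \<le> exp L"
    by (simp_all add: L_def ln_ge_zero)
  \<comment> \<open>The first bound makes maximal terms dominate in minors of order up to n + 1; the
    second covers the error after eliminating up to n + 1 vertices.\<close>
  define \<Lambda> where "\<Lambda> = max (ln (fact (Suc n) * U ^ Suc n)) (2 ^ Suc n * L)"
  obtain h :: "'g \<Rightarrow> real" where h_add: "\<And>x y. h (x + y) = h x + h y"
    and h_large: "\<And>x. x \<in> sumset D (2 ^ Suc n) \<Longrightarrow> 0 < x \<Longrightarrow> \<Lambda> < h x"
    using additive_large[OF finite_sumset[OF D(1), of "2 ^ Suc n"], of \<Lambda>] by blast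
  interpret real_hom h
    using h_add by unfold_locales
  have sumset_le: "sumset D p \<subseteq> sumset D (2 ^ Suc n)" if "p \<le> Suc n" for p
    using that by (intro sumset_mono[OF D(2)] order_trans[OF that less_imp_le[OF less_exp]])
  \<comment> \<open>An entry times a coordinate has two exponents, so comparing two such products
    involves a sum of two differences.\<close>
  have two_le: "1 + 1 \<le> (2 :: nat) ^ Suc n"
    by (induction n) simp_all
  have \<Lambda>_nonneg: "0 \<le> \<Lambda>"
    using L(1) by (simp add: \<Lambda>_def le_max_iff_disj)
  have minor_large: "fact p * U ^ p < exp (h x)" if "p \<le> Suc n" "x \<in> sumset D p" "0 < x" for p x
  proof -
    have "fact p * U ^ p \<le> fact (Suc n) * U ^ Suc n"
      using that(1) U by (intro mult_mono fact_mono power_increasing) auto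
    also have "\<dots> = exp (ln (fact (Suc n) * U ^ Suc n))"
      using U by (subst exp_ln) auto
    also have "\<dots> < exp (h x)"
      using h_large[of x] that sumset_le by (auto simp: \<Lambda>_def)
    finally show ?thesis .
  qed

  \<comment> \<open>Stated for every lift \<open>F\<close> with slack \<open>U\<close>: it serves
    both the program common to the whole run and the corrected programs of the individual
    bases.\<close>
  have chirotope: "det_sign (selmat F rs cs) = tper_sign (selmat (($$) M) rs cs)"
    if lift: "\<And>i j. i \<in> set rs \<Longrightarrow> j \<in> set cs \<Longrightarrow> lifts h U (M $$ (i, j)) (F (i, j))"
      and rs: "distinct rs" "set rs \<subseteq> {..<Suc m}" and cs: "distinct cs" "set cs \<subseteq> {..<Suc n}"
      and len: "length rs = length cs" for F rs cs
  proof -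
    define p where "p = length rs"
    have lens: "length rs = p" "length cs = p"
      using len by (simp_all add: p_def)
    have "p \<le> Suc n"
      using card_mono[OF _ cs(2)] distinct_card[OF cs(1)] lens by simp
    have mem: "rs ! i \<in> set rs" "cs ! i \<in> set cs" if "i < p" for i
      using that lens by auto
    have range: "rs ! i < Suc m" "cs ! i < Suc n" if "i < p" for i
      using mem[OF that] rs(2) cs(2) by auto
    show ?thesis
    proof (rule det_sign_lift_dominant)
      show "selmat (($$) M) rs cs \<in> carrier_mat p p" "selmat F rs cs \<in> carrier_mat p p"
        using selmat_carrier[of _ rs cs] lens by metis+
      show "lifts h U (selmat (($$) M) rs cs $$ (i, j)) (selmat F rs cs $$ (i, j))"
        if "i < p" "j < p" for i j
        using that lens mem lift by simp
      show "tper (selmat (($$) M) rs cs) = 0 \<or> trop_nonsingular (selmat (($$) M) rs cs)"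
        using generic rs cs len M by (intro trop_generic_selmat) (auto simp: M_def)
      show "a \<in> E" if "i < p" "j < p" "modulus (selmat (($$) M) rs cs $$ (i, j)) = TVal a" for i j a
        using that lens by (intro E_M[OF range(1)[of i] range(2)[of j]]) auto
      show "fact p * U ^ p < exp (h x)"
        if "x \<in> sumset {a - b | a b. a \<in> E \<and> b \<in> E} p" "0 < x" for x
        using \<open>p \<le> Suc n\<close> that by (intro minor_large) (simp_all add: D_def)
    qed
  qed

  define A' where "A' = map_mat canonical_lift A"
  define b' where "b' = map_vec canonical_lift b"
  define c' where "c' = map_vec (\<lambda>x. canonical_lift (to_signed x)) c"
  define M' where "M' = lp_matrix A' b' c'"
  have A': "A' \<in> carrier_mat m n" and b': "b' \<in> carrier_vec m" and c': "c' \<in> carrier_vec n"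
    using A b c by (simp_all add: A'_def b'_def c'_def)
  have M': "M' \<in> carrier_mat (Suc m) (Suc n)"
    unfolding M'_def using A' by (rule lp_matrix_carrier)
  have M'_index: "M' $$ (i, j) = canonical_lift (M $$ (i, j))" if "i < Suc m" "j < Suc n" for i j
    using that A b c by (auto simp: M'_def M_def lp_matrix_def A'_def b'_def c'_def)
  have M'_lifts: "lifts h V (M $$ (i, j)) (M' $$ (i, j))" if "i < Suc m" "j < Suc n" "1 \<le> V" for i j V
    using that by (simp add: M'_index lifts_canonical_lift)
  have aug_M': "aug A' b' (i, j) = M' $$ (i, j)" if "i < m" "j < Suc n" for i j
    unfolding M'_def by (rule aug_eq_lp_matrix[OF A' that])
  have chirotope_M': "det_sign (selmat (($$) M') rs cs) = tper_sign (selmat (($$) M) rs cs)"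
    if "distinct rs" "set rs \<subseteq> {..<Suc m}" "distinct cs" "set cs \<subseteq> {..<Suc n}"
      "length rs = length cs" for rs cs
    using that U by (intro chirotope M'_lifts) auto
  have chirotope_sub: "det_sign (submatrix M' I J) = tper_sign (submatrix M I J)"
    if "I \<subseteq> {..<Suc m}" "J \<subseteq> {..<Suc n}" "card I = card J" for I J
    using that finite_subset[OF that(1)] finite_subset[OF that(2)] M M'
    by (simp add: submatrix_eq_selmat chirotope_M')

  have signs_eq: "minor_oracle det_sign M' = minor_oracle tper_sign M"
    unfolding minor_oracle_def using M M' by (intro ext) (auto simp: chirotope_sub)

  have point: "\<exists>x\<in>trop_polyhedron A b. (\<forall>j<n. x $ j = 0 \<longleftrightarrow> x' $ j = 0) \<and>
      (\<forall>j<n. exp (h g) \<le> x' $ j \<longrightarrow> TVal g \<le> x $ j)" if "x' \<in> polyhedron A' b'" for x'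
  proof (rule tropicalize_real_point[OF A A' b b' _ that E _ L])
    show "lifts h U (aug A b (i, j)) (aug A' b' (i, j))" if "i < m" "j < Suc n" for i j
      using that U by (simp add: aug_M aug_M' M'_lifts)
    show "a \<in> E" if "i < m" "j < Suc n" "modulus (aug A b (i, j)) = TVal a" for i j a
      using that by (intro E_M[of i j]) (simp_all add: aug_M)
    show "2 ^ Suc n * L < h d"
      if "d \<in> sumset {a - b | a b. a \<in> E \<and> b \<in> E} (2 ^ Suc n)" "0 < d" for d
      using h_large[of d] that by (simp add: D_def \<Lambda>_def)
  qed
  have "nondegenerate_lp n m A' b' c'"
    unfolding nondegenerate_lp_def
  proof (intro conjI)
    show "\<exists>B. \<forall>x'\<in>polyhedron A' b'. \<forall>j<n. \<bar>x' $ j\<bar> \<le> B"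
    proof (intro exI ballI allI impI)
      fix x' j assume x': "x' \<in> polyhedron A' b'" and j: "j < n"
      have "0 \<le> x' $ j"
        using x' j mem_polyhedron_iff[OF A' b'] by blast
      \<comment> \<open>Otherwise some point of the tropical polyhedron would have a coordinate of
        at least g, against the strict bound.\<close>
      moreover have "\<not> exp (h g) \<le> x' $ j"
        using point[OF x'] g j by (metis not_less)
      ultimately show "\<bar>x' $ j\<bar> \<le> exp (h g)"
        by simp
    qed
    show "\<forall>x'\<in>polyhedron A' b'. \<forall>j<n. 0 < x' $ j"
    proof (intro ballI allI impI)
      fix x' j assume x': "x' \<in> polyhedron A' b'" and j: "j < n"
      have "0 \<le> x' $ j"
        using x' j mem_polyhedron_iff[OF A' b'] by blast
      moreover have "x' $ j \<noteq> 0"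
        using point[OF x'] pos j by metis
      ultimately show "0 < x' $ j"
        by simp
    qed
    show "generic (lp_matrix A' b' c')"
      unfolding generic_def Let_def M'_def[symmetric]
    proof (intro allI impI)
      fix I J assume *: "I \<subseteq> {..<dim_row M'} \<and> J \<subseteq> {..<dim_col M'} \<and> card I = card J"
      let ?W' = "submatrix M' I J" and ?W = "submatrix M I J"
      have IJ: "I \<subseteq> {..<Suc m}" "J \<subseteq> {..<Suc n}" "card I = card J"
        using * M' by auto
      have W: "?W = selmat (($$) M) (indices I) (indices J)"
        and W': "?W' = selmat (($$) M') (indices I) (indices J)"
        using IJ M M' by (auto intro!: submatrix_eq_selmat)
      have set_IJ: "set (indices I) \<subseteq> {..<Suc m}" "set (indices J) \<subseteq> {..<Suc n}"
        using IJ finite_subset[OF IJ(1)] finite_subset[OF IJ(2)] by auto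
      consider "tper ?W = 0" | "trop_nonsingular ?W"
        using generic IJ M unfolding trop_generic_def Let_def M_def[symmetric] by auto
      then show "det ?W' \<noteq> 0 \<or> (\<forall>p. p permutes {0..<dim_row ?W'} \<longrightarrow>
          of_int (sign p) * (\<Prod>i = 0..<dim_row ?W'. ?W' $$ (i, p i)) = 0)"
      proof cases
        \<comment> \<open>Each tropical term is at most the permanent, hence zero, and a lifted term
          is bounded by a multiple of its exponential.\<close>
        case 1
        have "(\<Prod>i = 0..<dim_row ?W'. ?W' $$ (i, p i)) = 0" if p: "p permutes {0..<dim_row ?W'}" for p
        proof -
          have "tper_term ?W p = 0"
            using tper_term_le[of p ?W] p 1 W W' by simp
          moreover have "lifts h 1 (?W $$ (i, p i)) (?W' $$ (i, p i))" if "i \<in> {0..<card I}" for i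
          proof -
            have "p i < card I"
              using permutes_in_image[OF p, of i] that W' by simp
            then show ?thesis
              using that IJ(3) subsetD[OF set_IJ(1) nth_mem[of i "indices I"]]
                subsetD[OF set_IJ(2) nth_mem[of "p i" "indices J"]]
              unfolding W W' by (auto intro!: M'_lifts)
          qed
          ultimately show ?thesis
            using prod_lifts_bounds(2)[of "{0..<card I}" 1 "\<lambda>i. ?W $$ (i, p i)" "\<lambda>i. ?W' $$ (i, p i)"]
              W W' by (simp add: tper_term_def)
        qed
        then show ?thesis by simp
      next
        case 2
        then have "det_sign ?W' \<noteq> 0"
          using chirotope_sub[OF IJ] tper_sign_nonzero by metis
        then show ?thesis by (auto simp: det_sign_def)
      qed
    qed
  qed (fact A' b' c')+

  moreover have "lp_basis A' b' I \<and> (\<forall>i. neg_reduced_cost A' c' I i \<longleftrightarrow> neg_trop_reduced_cost A c I i)"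
    if basis: "trop_basis A b I" for I
  proof
    have I: "I \<subseteq> {..<m}" "card I = n" and tper_I: "tper (submatrix A I UNIV) \<noteq> 0"
      using basis A by (simp_all add: trop_basis_def)
    have finI: "finite I"
      using I(1) finite_subset by blast
    have set_I: "set (indices I) \<subseteq> {..<Suc m}" and set_n: "set [0..<n] \<subseteq> {..<Suc n}"
      using I(1) finI by auto
    have x: "X I \<in> trop_polyhedron A b" "\<And>i. i \<in> I \<Longrightarrow> trop_lhs A b (X I) $ i = trop_rhs A b (X I) $ i"
      using X[OF basis] by auto
    have x_carrier: "X I \<in> carrier_vec n"
      using x(1) mem_trop_polyhedron_iff(1)[OF A b] by blast
    have E_hom: "a \<in> E" if "j < Suc n" "hom_coord (X I) j = TVal a" for j a
      using that x_carrier E(2) E_X[OF I(1), of j a]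
      by (auto simp: hom_coord_def one_trop_def split: if_splits)
    have "\<exists>A'' b''. A'' \<in> carrier_mat m n \<and> b'' \<in> carrier_vec m \<and>
        (\<forall>i<m. \<forall>j<Suc n. lifts h (real n + 2) (aug A b (i, j)) (aug A'' b'' (i, j))) \<and>
        (\<exists>x'\<in>polyhedron A'' b''. \<forall>i<m. trop_lhs A b (X I) $ i = trop_rhs A b (X I) $ i \<longrightarrow>
          row A'' i \<bullet> x' + b'' $ i = 0)"
    proof (rule realize_trop_point[OF A b x(1)])
      show "X I $ j \<noteq> 0" if "j < n" for j
        using pos[OF x(1) that] .
      fix i j k assume ijk: "i < m" "j < Suc n" "k < Suc n"
        and le: "modulus (aug A b (i, j)) * hom_coord (X I) j
          \<le> modulus (aug A b (i, k)) * hom_coord (X I) k"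
      show "texp h (modulus (aug A b (i, j)) * hom_coord (X I) j)
          \<le> texp h (modulus (aug A b (i, k)) * hom_coord (X I) k)"
      proof (cases "modulus (aug A b (i, j)) * hom_coord (X I) j")
        case (TVal s)
        then obtain a x0 where a: "modulus (aug A b (i, j)) = TVal a" "hom_coord (X I) j = TVal x0"
            "s = a + x0"
          by (cases "modulus (aug A b (i, j))"; cases "hom_coord (X I) j") auto
        obtain a' x0' where a': "modulus (aug A b (i, k)) = TVal a'" "hom_coord (X I) k = TVal x0'"
          using le TVal by (cases "modulus (aug A b (i, k))"; cases "hom_coord (X I) k") auto
        have in_E: "a \<in> E" "x0 \<in> E" "a' \<in> E" "x0' \<in> E"
          using a a' ijk E_M[of i j a] E_M[of i k a'] E_hom[of j x0] E_hom[of k x0']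
          by (simp_all add: aug_M)
        have "a + x0 \<le> a' + x0'"
          using le a a' by simp
        moreover have "h (a + x0) < h (a' + x0')" if "a + x0 < a' + x0'"
        proof -
          have "(a' - a) + (x0' - x0) \<in> sumset D (1 + 1)"
            using in_E by (intro sumset_add sumset_1 D_diff)
          then have "(a' - a) + (x0' - x0) \<in> sumset D (2 ^ Suc n)"
            by (rule subsetD[OF sumset_mono[OF D(2) two_le]])
          moreover have "(a' - a) + (x0' - x0) = (a' + x0') - (a + x0)"
            by simp
          ultimately have "\<Lambda> < h ((a' + x0') - (a + x0))"
            using that by (intro h_large) auto
          then show ?thesis
            using \<Lambda>_nonneg unfolding h_diff by linarith
        qed
        ultimately have "h (a + x0) \<le> h (a' + x0')"
          by (auto simp: order.order_iff_strict)
        then show ?thesis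
          using a a' by simp
      qed simp
    qed
    then obtain A'' b'' x' where A'': "A'' \<in> carrier_mat m n" and b'': "b'' \<in> carrier_vec m"
      and lift'': "\<And>i j. i < m \<Longrightarrow> j < Suc n \<Longrightarrow> lifts h U (aug A b (i, j)) (aug A'' b'' (i, j))"
      and x': "x' \<in> polyhedron A'' b''"
        "\<And>i. i < m \<Longrightarrow> trop_lhs A b (X I) $ i = trop_rhs A b (X I) $ i \<Longrightarrow> row A'' i \<bullet> x' + b'' $ i = 0"
      unfolding U_def by blast
    \<comment> \<open>\<open>A''\<close> is corrected for this one basis while \<open>A'\<close>
      serves all of them; both carry the signs of \<open>M\<close>, which moves the basis from one
      to the other.\<close>
    have signs'': "det_sign (selmat (aug A'' b'') rs cs) = tper_sign (selmat (($$) M) rs cs)"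
      if "distinct rs" "distinct cs" "set rs \<subseteq> {..<m}" "set cs \<subseteq> {..n}" "length rs = length cs" for rs cs
      using that lift'' by (intro chirotope) (auto simp: subset_iff less_Suc_eq_le simp flip: aug_M)
    have signs': "det_sign (selmat (aug A' b') rs cs) = tper_sign (selmat (($$) M) rs cs)"
      if "distinct rs" "distinct cs" "set rs \<subseteq> {..<m}" "set cs \<subseteq> {..n}" "length rs = length cs" for rs cs
      using that U by (intro chirotope) (auto simp: subset_iff less_Suc_eq_le aug_M' intro!: M'_lifts)
    have sub_I: "submatrix A I UNIV = selmat (($$) M) (indices I) [0..<n]"
      unfolding M_def by (rule submatrix_eq_selmat_lp_matrix[OF A I])
    have "trop_nonsingular (submatrix A I UNIV)"
      using tper_I trop_generic_selmat[OF generic, of "indices I" "[0..<n]"] set_I set_n M I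
      unfolding sub_I M_def[symmetric] by auto
    then have "tper_sign (submatrix A I UNIV) \<noteq> 0"
      by (rule tper_sign_nonzero)
    moreover have "set [0..<n] \<subseteq> {..n}"
      by auto
    ultimately have "det_sign (submatrix A'' I UNIV) \<noteq> 0"
      using signs''[of "indices I" "[0..<n]"] I finI
      unfolding sub_I submatrix_eq_selmat_aug[OF A'' I, of b''] by auto
    then have "det (submatrix A'' I UNIV) \<noteq> 0"
      by (auto simp: det_sign_def)
    then have "lp_basis A'' b'' I"
      using I A'' x' x(2) by (auto simp: lp_basis_def subset_iff)
    then show "lp_basis A' b' I"
      using signs' signs'' by (intro lp_basis_cong_signs[OF A'' A' b'' b']) auto

    have "sgn (reduced_cost A' c' I i) = of_int (trop_reduced_cost_sign A c I i)" for i
    proof -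
      have "sgn (det (submatrix (replace_row A' i c') I UNIV)) =
          of_int (tper_sign (submatrix (replace_row A i (map_vec to_signed c)) I UNIV))"
        unfolding submatrix_replace_row_eq_selmat[OF A' I, of i c' b']
          submatrix_replace_row_eq_selmat[OF A I, of i "map_vec to_signed c" b]
          M_def[symmetric] M'_def[symmetric] of_int_det_sign[symmetric]
        using exchange_indices[OF I(1)] I set_n by (subst chirotope_M') auto
      moreover have "sgn (det (submatrix A' I UNIV)) = of_int (tper_sign (submatrix A I UNIV))"
        unfolding submatrix_eq_selmat_lp_matrix[OF A' I, of b' c'] sub_I
          M'_def[symmetric] of_int_det_sign[symmetric]
        using set_I I set_n by (subst chirotope_M') auto
      moreover have "sgn (x / y) = sgn x * sgn y" for x y :: real
        by (auto simp: sgn_real_def divide_less_0_iff zero_less_divide_iff)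
      ultimately show ?thesis
        by (simp only: reduced_cost_def trop_reduced_cost_sign_def of_int_mult)
    qed
    then have "reduced_cost A' c' I i < 0 \<longleftrightarrow> trop_reduced_cost_sign A c I i < 0" for i
      by (metis of_int_less_0_iff sgn_less)
    then show "\<forall>i. neg_reduced_cost A' c' I i \<longleftrightarrow> neg_trop_reduced_cost A c I i"
      by (simp add: neg_reduced_cost_def neg_trop_reduced_cost_def)
  qed
  ultimately show ?thesis
    using signs_eq unfolding M_def M'_def by blast
qed

end

text \<open>By \<open>pivot\<close>, every set in the run is a basis of the first kind, so an
  implication between the two notions of basis suffices. The exchange relation between consecutive
  sets does not mention the program.\<close>

lemma simplex_run_transfer:
  assumes run: "simplex_run basis neg \<psi> Is"
    and basis: "\<And>I. basis I \<Longrightarrow> basis' I"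
    and neg: "\<And>I i. basis I \<Longrightarrow> neg' I i \<longleftrightarrow> neg I i"
  shows "simplex_run basis' neg' \<psi> Is"
proof -
  have all_bases: "basis (Is ! k)" if "k < length Is" for k
  proof (cases k)
    case 0
    then show ?thesis
      using run by (metis hd_conv_nth simplex_run_def)
  next
    case (Suc l)
    then show ?thesis
      using run that by (auto simp: simplex_run_def pivot_def)
  qed
  have "basis (last Is)"
    using run all_bases[of "length Is - 1"] by (auto simp: simplex_run_def last_conv_nth)
  then have "optimal neg' (last Is)"
    using run neg by (auto simp: simplex_run_def optimal_def)
  moreover have "pivot basis' neg' (Is ! k) (\<psi> (take (Suc k) Is)) (Is ! Suc k)" if "Suc k < length Is" for k
    using run that basis neg by (auto simp: simplex_run_def pivot_def)
  ultimately show ?thesis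
    using run basis by (auto simp: simplex_run_def)
qed

theorem proposition4p1:
  fixes n m :: nat and \<phi> :: combinatorial_rule
  assumes divisible: "\<And>(g :: 'g::linordered_ab_group_add) k :: nat. 0 < k \<Longrightarrow> \<exists>h. (\<Sum>i<k. h) = g"
    and "0 < n" and "0 < m"
    and "pivoting_strategy n m (classical_strategy \<phi>)"
  shows "N_trop n m (tropicalized_strategy \<phi> :: 'g trop_strategy)
           \<le> N_real n m (classical_strategy \<phi>)"
  unfolding N_trop_def
proof (rule Sup_least)
  interpret divisible_group "TYPE('g)"
    using divisible by unfold_locales
  fix l :: enat
  assume "l \<in> {enat (length Is) | Is A b c.
     nondegenerate_trop_lp n m A b (c :: 'g trop vec) \<and>
     simplex_run (trop_basis A b) (neg_trop_reduced_cost A c)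
       (\<lambda>h. tropicalized_strategy \<phi> h A b c) Is}"
  then obtain Is and A :: "'g signed_trop mat" and b c where l: "l = enat (length Is)"
    and nondeg: "nondegenerate_trop_lp n m A b c"
    and run: "simplex_run (trop_basis A b) (neg_trop_reduced_cost A c)
      (\<lambda>h. tropicalized_strategy \<phi> h A b c) Is"
    by blast
  obtain A' b' c' where nondeg': "nondegenerate_lp n m A' b' c'"
    and signs_eq: "minor_oracle det_sign (lp_matrix A' b' c') = minor_oracle tper_sign (trop_lp_matrix A b c)"
    and basis: "\<And>I. trop_basis A b I \<Longrightarrow> lp_basis A' b' I"
    and cost: "\<And>I i. trop_basis A b I \<Longrightarrow> neg_reduced_cost A' c' I i \<longleftrightarrow> neg_trop_reduced_cost A c I i"
    using real_lift_of_program[OF nondeg] by blast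
  have "simplex_run (lp_basis A' b') (neg_reduced_cost A' c')
      (\<lambda>h. tropicalized_strategy \<phi> h A b c) Is"
    using run basis cost by (rule simplex_run_transfer)
  \<comment> \<open>A combinatorial rule sees the program only through the oracle, and the two
    oracles are equal as functions.\<close>
  then have "simplex_run (lp_basis A' b') (neg_reduced_cost A' c')
      (\<lambda>h. classical_strategy \<phi> h A' b' c') Is"
    by (simp add: classical_strategy_def tropicalized_strategy_def signs_eq)
  with nondeg' show "l \<le> N_real n m (classical_strategy \<phi>)"
    unfolding N_real_def l by (intro Sup_upper) blast
qed

end
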